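(* Let $p>1$ and $0<\gamma<1$. Let $a\in L^1(\Omega)$ satisfy $a\ge c_0$ a.e. in $\Omega$ for some constant $c_0>0$, and let $0\le f\in L^\infty(\Omega)$. Then there exists $\mu_{0*}>0$ such that, for any $0<\mu<\mu_{0*}$, the problem $$-\Delta_p u+\frac{a(x)}{u^{\gamma}}=\mu f(x)\ \text{ in }\Omega,\qquad u=0\ \text{ on }\partial\Omega \tag{P}$$ does not admit a finite energy solution.
   Context: $\Omega\subset\mathbb{R}^N$ ($N\ge2$) is a bounded open set with smooth boundary and $\Delta_p u=\operatorname{div}(|\nabla u|^{p-2}\nabla u)$. For $k>0$, $T_k(s)=\max(-k,\min(s,k))$. Generalized gradient: if $u$ is measurable with $T_k(u)\in W^{1,1}_{\rm loc}(\Omega)$ for every $k>0$, then $\nabla u$ denotes the a.e. unique measurable vector field $v$ with $\nabla T_k(u)=v\chi_{\{|u|\le k\}}$ a.e. in $\Omega$ for every $k>0$. Solution: a nonnegative measurable function $u$ is a (distributional) solution of (P) if $T_k(u)\in W^{1,1}_0(\Omega)$ for every $k>0$, both $|\nabla u|^{p-1}$ and $au^{-\gamma}$ (which equals $+\infty$ where $u=0$, since $a>0$) belong to $L^1_{\rm loc}(\Omega)$, and $$\int_\Omega|\nabla u|^{p-2}\nabla u\cdot\nabla\varphi+\int_\Omega\frac{a\varphi}{u^\gamma}=\mu\int_\Omega f\varphi\quad\text{for all }\varphi\in C^1_c(\Omega).$$ A finite energy solution is a solution that belongs to $W^{1,p}_0(\Omega)$. *)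

theory Defs
  imports "HOL-Analysis.Analysis"
begin

section \<open>Classical smoothness\<close>

text \<open>For open \<open>S\<close>, \<open>C_on k S\<close> is the class of \<open>k\<close> times continuously differentiable functions.\<close>

primrec C_on :: "nat \<Rightarrow> 'a::euclidean_space set \<Rightarrow> ('a \<Rightarrow> real) \<Rightarrow> bool" where
  "C_on 0 S f \<longleftrightarrow> continuous_on S f"
| "C_on (Suc k) S f \<longleftrightarrow>
     (\<forall>x\<in>S. f differentiable (at x)) \<and>
     (\<forall>h. C_on k S (\<lambda>x. frechet_derivative f (at x) h))"

definition grad :: "('a::euclidean_space \<Rightarrow> real) \<Rightarrow> 'a \<Rightarrow> 'a" where
  "grad f x = (\<Sum>b\<in>Basis. frechet_derivative f (at x) b *\<^sub>R b)"

text \<open>Functions with compact support in \<open>\<Omega>\<close> are identified with their extension by \<open>0\<close> to the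
  whole space.\<close>

definition compact_support_in :: "'a::euclidean_space set \<Rightarrow> ('a \<Rightarrow> real) \<Rightarrow> bool" where
  "compact_support_in \<Omega> \<phi> \<longleftrightarrow>
     compact (closure {x. \<phi> x \<noteq> 0}) \<and> closure {x. \<phi> x \<noteq> 0} \<subseteq> \<Omega>"

definition C1_c :: "'a::euclidean_space set \<Rightarrow> ('a \<Rightarrow> real) set" where
  "C1_c \<Omega> = {\<phi>. C_on 1 UNIV \<phi> \<and> compact_support_in \<Omega> \<phi>}"

definition Cinf_c :: "'a::euclidean_space set \<Rightarrow> ('a \<Rightarrow> real) set" where
  "Cinf_c \<Omega> = {\<phi>. (\<forall>k. C_on k UNIV \<phi>) \<and> compact_support_in \<Omega> \<phi>}"

text \<open>Near each boundary point, in suitably rotated coordinates with last axis \<open>e\<close>, the set is the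
  strict epigraph of a smooth function \<open>g\<close> of the remaining coordinates \<open>x - (x \<bullet> e) e\<close>; only the
  restriction of \<open>g\<close> to the hyperplane orthogonal to \<open>e\<close> matters.\<close>

definition smooth_boundary :: "'a::euclidean_space set \<Rightarrow> bool" where
  "smooth_boundary \<Omega> \<longleftrightarrow>
     (\<forall>x0\<in>frontier \<Omega>. \<exists>r>0. \<exists>e g. norm e = 1 \<and> (\<forall>k. C_on k UNIV g) \<and>
        \<Omega> \<inter> ball x0 r = {x \<in> ball x0 r. x \<bullet> e > g (x - (x \<bullet> e) *\<^sub>R e)})"

section \<open>Lebesgue and Sobolev spaces\<close>

definition L_on :: "real \<Rightarrow> 'a::euclidean_space set \<Rightarrow> ('a \<Rightarrow> 'b::euclidean_space) \<Rightarrow> bool" where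
  "L_on p \<Omega> u \<longleftrightarrow> u \<in> borel_measurable (lebesgue_on \<Omega>) \<and>
     integrable (lebesgue_on \<Omega>) (\<lambda>x. norm (u x) powr p)"

definition Linf_on :: "'a::euclidean_space set \<Rightarrow> ('a \<Rightarrow> real) \<Rightarrow> bool" where
  "Linf_on \<Omega> u \<longleftrightarrow> u \<in> borel_measurable (lebesgue_on \<Omega>) \<and>
     (\<exists>M. AE x in lebesgue_on \<Omega>. \<bar>u x\<bar> \<le> M)"

definition L1_loc :: "'a::euclidean_space set \<Rightarrow> ('a \<Rightarrow> 'b::euclidean_space) \<Rightarrow> bool" where
  "L1_loc \<Omega> u \<longleftrightarrow> u \<in> borel_measurable (lebesgue_on \<Omega>) \<and>
     (\<forall>K. compact K \<and> K \<subseteq> \<Omega> \<longrightarrow> integrable (lebesgue_on K) u)"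

definition L1_loc_ereal :: "'a::euclidean_space set \<Rightarrow> ('a \<Rightarrow> ereal) \<Rightarrow> bool" where
  "L1_loc_ereal \<Omega> F \<longleftrightarrow> F \<in> borel_measurable (lebesgue_on \<Omega>) \<and>
     (\<forall>K. compact K \<and> K \<subseteq> \<Omega> \<longrightarrow> (\<integral>\<^sup>+x. e2ennreal \<bar>F x\<bar> \<partial>lebesgue_on K) < \<infinity>)"

text \<open>\<open>u\<close> belongs to \<open>W\<^sup>1\<^sup>,\<^sup>1\<close> locally in \<open>\<Omega>\<close> and \<open>g\<close> is (a representative of) its weak gradient.\<close>

definition has_weak_gradient ::
    "'a::euclidean_space set \<Rightarrow> ('a \<Rightarrow> real) \<Rightarrow> ('a \<Rightarrow> 'a) \<Rightarrow> bool" where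
  "has_weak_gradient \<Omega> u g \<longleftrightarrow> L1_loc \<Omega> u \<and> L1_loc \<Omega> g \<and>
     (\<forall>\<phi>\<in>Cinf_c \<Omega>. (\<integral>x. u x *\<^sub>R grad \<phi> x \<partial>lebesgue_on \<Omega>) = - (\<integral>x. \<phi> x *\<^sub>R g x \<partial>lebesgue_on \<Omega>))"

text \<open>The \<open>W\<^sup>1\<^sup>,\<^sup>p\<close> norm of a function \<open>u\<close> with weak gradient \<open>g\<close>.\<close>

definition sobolev_norm ::
    "real \<Rightarrow> 'a::euclidean_space set \<Rightarrow> ('a \<Rightarrow> real) \<Rightarrow> ('a \<Rightarrow> 'a) \<Rightarrow> real" where
  "sobolev_norm p \<Omega> u g =
     ((\<integral>x. \<bar>u x\<bar> powr p \<partial>lebesgue_on \<Omega>) + (\<integral>x. norm (g x) powr p \<partial>lebesgue_on \<Omega>)) powr (1 / p)"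

text \<open>The closure of the test functions in \<open>W\<^sup>1\<^sup>,\<^sup>p\<close>, for \<open>p \<ge> 1\<close>.\<close>

definition W0 :: "real \<Rightarrow> 'a::euclidean_space set \<Rightarrow> ('a \<Rightarrow> real) \<Rightarrow> bool" where
  "W0 p \<Omega> u \<longleftrightarrow>
     (\<exists>g. has_weak_gradient \<Omega> u g \<and> L_on p \<Omega> u \<and> L_on p \<Omega> g \<and>
        (\<forall>\<epsilon>>0. \<exists>\<phi>\<in>Cinf_c \<Omega>. sobolev_norm p \<Omega> (\<lambda>x. u x - \<phi> x) (\<lambda>x. g x - grad \<phi> x) < \<epsilon>))"

section \<open>Solutions of the singular problem\<close>

definition trunc :: "real \<Rightarrow> real \<Rightarrow> real" where
  "trunc k s = max (- k) (min s k)"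

definition has_generalized_gradient ::
    "'a::euclidean_space set \<Rightarrow> ('a \<Rightarrow> real) \<Rightarrow> ('a \<Rightarrow> 'a) \<Rightarrow> bool" where
  "has_generalized_gradient \<Omega> u v \<longleftrightarrow>
     u \<in> borel_measurable (lebesgue_on \<Omega>) \<and> v \<in> borel_measurable (lebesgue_on \<Omega>) \<and>
     (\<forall>k>0. has_weak_gradient \<Omega> (\<lambda>x. trunc k (u x))
        (\<lambda>x. indicat_real {y. \<bar>u y\<bar> \<le> k} x *\<^sub>R v x))"

text \<open>\<open>a u\<^sup>-\<^sup>\<gamma>\<close> is extended-real-valued, with \<open>0\<^sup>-\<^sup>\<gamma> = \<infinity>\<close>, whereas in HOL \<open>0 powr (- \<gamma>) = 0\<close>.\<close>

definition singular_term ::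
    "('a \<Rightarrow> real) \<Rightarrow> real \<Rightarrow> ('a \<Rightarrow> real) \<Rightarrow> 'a \<Rightarrow> ereal" where
  "singular_term a \<gamma> u x = ereal (a x) * (if u x = 0 then \<infinity> else ereal (u x powr (- \<gamma>)))"

text \<open>The generalized gradient \<open>v\<close> of \<open>u\<close> is a.e. unique, so the existential quantifier merely
  picks a representative. At zeros of \<open>v\<close> the field \<open>|v|\<^sup>p\<^sup>-\<^sup>2 v\<close> is \<open>0\<close>. Since \<open>singular_term a \<gamma> u\<close>
  is locally integrable, it is finite a.e., so nothing is lost by \<^const>\<open>real_of_ereal\<close> in the
  integral.\<close>

definition solution ::
    "'a::euclidean_space set \<Rightarrow> real \<Rightarrow> real \<Rightarrow> ('a \<Rightarrow> real) \<Rightarrow> ('a \<Rightarrow> real) \<Rightarrow> real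
      \<Rightarrow> ('a \<Rightarrow> real) \<Rightarrow> bool" where
  "solution \<Omega> p \<gamma> a f \<mu> u \<longleftrightarrow>
     u \<in> borel_measurable (lebesgue_on \<Omega>) \<and> (AE x in lebesgue_on \<Omega>. u x \<ge> 0) \<and>
     (\<forall>k>0. W0 1 \<Omega> (\<lambda>x. trunc k (u x))) \<and>
     (\<exists>v. has_generalized_gradient \<Omega> u v \<and>
        L1_loc \<Omega> (\<lambda>x. norm (v x) powr (p - 1)) \<and>
        L1_loc_ereal \<Omega> (singular_term a \<gamma> u) \<and>
        (\<forall>\<phi>\<in>C1_c \<Omega>.
           (\<integral>x. norm (v x) powr (p - 2) * (v x \<bullet> grad \<phi> x) \<partial>lebesgue_on \<Omega>)
           + (\<integral>x. real_of_ereal (singular_term a \<gamma> u x) * \<phi> x \<partial>lebesgue_on \<Omega>)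
           = \<mu> * (\<integral>x. f x * \<phi> x \<partial>lebesgue_on \<Omega>)))"

definition finite_energy_solution ::
    "'a::euclidean_space set \<Rightarrow> real \<Rightarrow> real \<Rightarrow> ('a \<Rightarrow> real) \<Rightarrow> ('a \<Rightarrow> real) \<Rightarrow> real
      \<Rightarrow> ('a \<Rightarrow> real) \<Rightarrow> bool" where
  "finite_energy_solution \<Omega> p \<gamma> a f \<mu> u \<longleftrightarrow> solution \<Omega> p \<gamma> a f \<mu> u \<and> W0 p \<Omega> u"

end

theory Submission
  imports Defs
begin

text \<open>
  If \<open>u\<close> is a finite energy solution, the equation may be tested with \<open>u\<close> itself, and since
  \<open>a \<ge> c\<^sub>0\<close> and \<open>0 \<le> f \<le> M\<close> this gives
  \<open>\<integral> |\<nabla>u|\<^sup>p + c\<^sub>0 \<integral> u\<^sup>1\<^sup>-\<^sup>\<gamma> \<le> \<mu> M \<integral> u\<close>  (\<open>energy_inequality\<close>).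
  The exponent \<open>1\<close> lies between \<open>1 - \<gamma>\<close> and \<open>p\<close>, hence \<open>u \<le> u\<^sup>1\<^sup>-\<^sup>\<gamma> + u\<^sup>p\<close>, and Poincare's inequality
  \<open>\<integral> u\<^sup>p \<le> C \<integral> |\<nabla>u|\<^sup>p\<close> (\<open>Poincare_W0\<close>) bounds the right-hand side by
  \<open>\<mu> M (\<integral> u\<^sup>1\<^sup>-\<^sup>\<gamma> + C \<integral> |\<nabla>u|\<^sup>p)\<close>. As soon as \<open>\<mu> M C < 1\<close> and \<open>\<mu> M < c\<^sub>0\<close>, both sides must vanish, so
  \<open>u = 0\<close> almost everywhere. But a solution is positive almost everywhere, because \<open>a u\<^sup>-\<^sup>\<gamma>\<close> is locally
  integrable and infinite where \<open>u\<close> vanishes (\<open>solution_positive\<close>).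

  Two points need care. First, \<open>u\<close> is not an admissible test function. Let \<open>\<phi>\<^sub>n\<close> be smooth, compactly
  supported and convergent to \<open>u\<close> in \<open>W\<^sup>1\<^sup>,\<^sup>p\<close> and almost everywhere. The test functions used are
  smoothed positive parts of the \<open>\<phi>\<^sub>n\<close> (\<open>soft_pos\<close>): they are \<open>C\<^sup>1\<close>, so admissible, and nonnegative, so
  that the singular term, about which only local integrability is known, can be bounded from below
  before passing to the limit. In the flux term the derivative of the smoothed positive part tends
  to \<open>1\<close> because \<open>u > 0\<close>.

  Second, the equation contains the generalized gradient \<open>v\<close> of \<open>u\<close>, defined by its truncations,
  whereas the approximation controls the weak gradient \<open>g\<close> of \<open>u\<close>. That \<open>v = g\<close> almost everywhere
  (\<open>generalized_gradient_eq_weak_gradient\<close>) follows from the chain rule applied to \<open>C\<^sup>1\<close> functions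
  \<open>\<psi>\<close> that are constant outside \<open>[-k, k]\<close>, for which \<open>\<psi> \<circ> T\<^sub>k = \<psi>\<close>, together with the uniqueness of weak
  gradients. The latter is the fundamental lemma of the calculus of variations and rests on an
  explicit family of smooth bump functions on boxes.

  The constant in Poincare's inequality comes from integrating the divergence of the field
  \<open>(x \<bullet> e) |\<phi>|\<^sup>p e\<close> over the bounded set \<open>\<Omega>\<close> (\<open>Poincare_test\<close>).
\<close>

section \<open>Gradients of continuously differentiable functions\<close>

lemma frechet_derivative_eq_grad_inner:
  fixes f :: "'a::euclidean_space \<Rightarrow> real"
  assumes "f differentiable (at x)"
  shows "frechet_derivative f (at x) h = grad f x \<bullet> h"
proof -
  have lin: "linear (frechet_derivative f (at x))"
    by (rule linear_frechet_derivative[OF assms])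
  have "frechet_derivative f (at x) h = frechet_derivative f (at x) (\<Sum>b\<in>Basis. (h \<bullet> b) *\<^sub>R b)"
    by (simp add: euclidean_representation)
  also have "\<dots> = (\<Sum>b\<in>Basis. (h \<bullet> b) * frechet_derivative f (at x) b)"
    by (simp add: linear_sum[OF lin] linear_cmul[OF lin])
  also have "\<dots> = grad f x \<bullet> h"
    unfolding grad_def inner_sum_left inner_scaleR_left inner_commute[of h]
    by (simp only: mult.commute)
  finally show ?thesis .
qed

lemma C1_has_derivative:
  assumes "C_on 1 UNIV f"
  shows "(f has_derivative (\<lambda>h. grad f x \<bullet> h)) (at x)"
proof -
  have d: "f differentiable (at x)" using assms by simp
  then have "(f has_derivative frechet_derivative f (at x)) (at x)"
    by (simp add: frechet_derivative_works)
  moreover have "frechet_derivative f (at x) = (\<lambda>h. grad f x \<bullet> h)"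
    using frechet_derivative_eq_grad_inner[OF d] by auto
  ultimately show ?thesis by simp
qed

lemma C1_continuous_grad: "C_on 1 UNIV f \<Longrightarrow> continuous_on UNIV (grad f)"
  unfolding grad_def[abs_def] by (intro continuous_intros) simp

lemma C1_continuous:
  assumes "C_on 1 UNIV f" shows "continuous_on UNIV f"
  using C1_has_derivative[OF assms] has_derivative_continuous
  by (metis continuous_at_imp_continuous_on)

lemma has_derivative_imp_grad:
  assumes "(f has_derivative (\<lambda>h. g \<bullet> h)) (at x)"
  shows "grad f x = g"
proof -
  have "frechet_derivative f (at x) = (\<lambda>h. g \<bullet> h)"
    using frechet_derivative_at[OF assms] by simp
  then show ?thesis by (simp add: grad_def euclidean_representation)
qed

lemma C1I:
  assumes "\<And>x. (f has_derivative (\<lambda>h. G x \<bullet> h)) (at x)" and "continuous_on UNIV G"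
  shows "C_on 1 UNIV f" and "grad f = G"
proof -
  have "frechet_derivative f (at x) = (\<lambda>h. G x \<bullet> h)" for x
    using frechet_derivative_at[OF assms(1)] by simp
  then show "C_on 1 UNIV f"
    using assms by (auto simp: differentiable_def intro!: continuous_intros)
  show "grad f = G" using has_derivative_imp_grad[OF assms(1)] by auto
qed

lemma C1_compose:
  assumes f: "C_on 1 UNIV f"
    and psi: "\<And>s. (\<psi> has_real_derivative \<psi>' s) (at s)" and cont: "continuous_on UNIV \<psi>'"
  shows "C_on 1 UNIV (\<lambda>x. \<psi> (f x))" and "grad (\<lambda>x. \<psi> (f x)) = (\<lambda>x. \<psi>' (f x) *\<^sub>R grad f x)"
proof -
  have "((\<lambda>x. \<psi> (f x)) has_derivative (\<lambda>h. (\<psi>' (f x) *\<^sub>R grad f x) \<bullet> h)) (at x)" for x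
    using has_derivative_compose[OF C1_has_derivative[OF f] psi[unfolded has_field_derivative_def]]
    by (simp add: mult.commute)
  moreover have "continuous_on UNIV (\<lambda>x. \<psi>' (f x) *\<^sub>R grad f x)"
    by (intro continuous_intros C1_continuous_grad f
        continuous_on_compose2[OF cont C1_continuous[OF f]]) auto
  ultimately show "C_on 1 UNIV (\<lambda>x. \<psi> (f x))"
    and "grad (\<lambda>x. \<psi> (f x)) = (\<lambda>x. \<psi>' (f x) *\<^sub>R grad f x)"
    by (rule C1I)+
qed

lemma C1_mult:
  assumes f: "C_on 1 UNIV f" and g: "C_on 1 UNIV g"
  shows "C_on 1 UNIV (\<lambda>x. f x * g x)"
    and "grad (\<lambda>x. f x * g x) = (\<lambda>x. f x *\<^sub>R grad g x + g x *\<^sub>R grad f x)"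
proof -
  have "((\<lambda>x. f x * g x) has_derivative (\<lambda>h. (f x *\<^sub>R grad g x + g x *\<^sub>R grad f x) \<bullet> h)) (at x)" for x
    using has_derivative_mult[OF C1_has_derivative[OF f] C1_has_derivative[OF g]]
    by (simp add: inner_add_left mult.commute)
  moreover have "continuous_on UNIV (\<lambda>x. f x *\<^sub>R grad g x + g x *\<^sub>R grad f x)"
    by (intro continuous_intros C1_continuous_grad C1_continuous f g)
  ultimately show "C_on 1 UNIV (\<lambda>x. f x * g x)"
    and "grad (\<lambda>x. f x * g x) = (\<lambda>x. f x *\<^sub>R grad g x + g x *\<^sub>R grad f x)"
    by (rule C1I)+
qed

lemma Cinf_c_imp_C1_c: "\<phi> \<in> Cinf_c \<Omega> \<Longrightarrow> \<phi> \<in> C1_c \<Omega>"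
  unfolding Cinf_c_def C1_c_def by blast

lemma C1_cD: "\<phi> \<in> C1_c \<Omega> \<Longrightarrow> C_on 1 UNIV \<phi>"
  by (simp add: C1_c_def)

lemma zero_outside_support: "x \<notin> closure {x. \<phi> x \<noteq> 0} \<Longrightarrow> \<phi> x = 0"
  using closure_subset[of "{x. \<phi> x \<noteq> 0}"] by blast

lemma grad_zero_outside_support:
  assumes "x \<notin> closure {x. \<phi> x \<noteq> 0}"
  shows "grad \<phi> x = 0"
proof (rule has_derivative_imp_grad)
  have "((\<lambda>x. 0) has_derivative (\<lambda>h. 0)) (at x)" by simp
  then show "(\<phi> has_derivative (\<lambda>h. 0 \<bullet> h)) (at x)"
    unfolding inner_zero_left
  proof (rule has_derivative_transform_within_open)
    show "open (- closure {x. \<phi> x \<noteq> 0})" by (rule open_Compl[OF closed_closure])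
    show "x \<in> - closure {x. \<phi> x \<noteq> 0}" using assms by blast
    show "y \<in> - closure {x. \<phi> x \<noteq> 0} \<Longrightarrow> 0 = \<phi> y" for y
      using zero_outside_support[of y \<phi>] by (metis ComplD)
  qed
qed

lemma compact_support_in_mono:
  assumes "compact_support_in \<Omega> \<phi>" and "\<And>x. \<phi> x = 0 \<Longrightarrow> \<eta> x = 0"
  shows "compact_support_in \<Omega> \<eta>"
proof -
  have "closure {x. \<eta> x \<noteq> 0} \<subseteq> closure {x. \<phi> x \<noteq> 0}"
    by (rule closure_mono) (use assms(2) in auto)
  with assms(1) show ?thesis
    unfolding compact_support_in_def compact_eq_bounded_closed
    by (blast intro: bounded_subset closed_closure)
qed

lemma continuous_compact_support_bounded:
  fixes h :: "'a::euclidean_space \<Rightarrow> 'b::real_normed_vector"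
  assumes "continuous_on UNIV h" and "compact K" and "\<And>x. x \<notin> K \<Longrightarrow> h x = 0"
  obtains B where "B > 0" and "\<And>x. norm (h x) \<le> B"
proof -
  have "compact (h ` K)" using assms by (meson compact_continuous_image continuous_on_subset top_greatest)
  then obtain B where "B > 0" "\<And>y. y \<in> h ` K \<Longrightarrow> norm y \<le> B"
    using compact_imp_bounded bounded_pos by metis
  then have "norm (h x) \<le> B" for x using assms(3)[of x] by (cases "x \<in> K") auto
  then show ?thesis using \<open>B > 0\<close> that by blast
qed

lemma C1_c_bounded:
  assumes "\<phi> \<in> C1_c \<Omega>"
  obtains B where "B > 0" and "\<And>x. \<bar>\<phi> x\<bar> \<le> B" and "\<And>x. norm (grad \<phi> x) \<le> B"
proof -
  let ?K = "closure {x. \<phi> x \<noteq> 0}"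
  have K: "compact ?K" and C1: "C_on 1 UNIV \<phi>"
    using assms by (auto simp: C1_c_def compact_support_in_def)
  obtain B1 where B1: "B1 > 0" "\<And>x. norm (\<phi> x) \<le> B1"
    using continuous_compact_support_bounded[OF C1_continuous[OF C1] K] zero_outside_support by metis
  obtain B2 where B2: "B2 > 0" "\<And>x. norm (grad \<phi> x) \<le> B2"
    using continuous_compact_support_bounded[OF C1_continuous_grad[OF C1] K]
      grad_zero_outside_support by metis
  show ?thesis
    using that[of "max B1 B2"] B1 B2 by (simp add: max.coboundedI1 max.coboundedI2)
qed

lemma continuous_measurable_lebesgue_on:
  fixes h :: "'a::euclidean_space \<Rightarrow> 'b::euclidean_space"
  assumes "continuous_on UNIV h"
  shows "h \<in> borel_measurable (lebesgue_on S)"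
  by (intro measurable_restrict_space1 measurable_completion)
     (use borel_measurable_continuous_onI[OF assms] in simp)

section \<open>Integrals of gradients of compactly supported functions\<close>

lemma lborel_integral_translate:
  fixes f :: "'a::euclidean_space \<Rightarrow> real"
  assumes "integrable lborel f"
  shows "integrable lborel (\<lambda>x. f (c + x))" and "(\<integral>x. f (c + x) \<partial>lborel) = (\<integral>x. f x \<partial>lborel)"
proof -
  have m: "f \<in> borel_measurable borel" using assms by (simp add: borel_measurable_integrable)
  have "integrable (distr lborel borel ((+) c)) f" using assms by (simp add: lborel_distr_plus)
  then show "integrable lborel (\<lambda>x. f (c + x))"
    by (subst (asm) integrable_distr_eq) (use m in auto)
  have "(\<integral>x. f x \<partial>lborel) = (\<integral>x. f x \<partial>(distr lborel borel ((+) c)))" by (simp add: lborel_distr_plus)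
  also have "\<dots> = (\<integral>x. f (c + x) \<partial>lborel)" by (subst integral_distr) (use m in auto)
  finally show "(\<integral>x. f (c + x) \<partial>lborel) = (\<integral>x. f x \<partial>lborel)" by simp
qed

lemma integrable_continuous_compact_support:
  fixes h :: "'a::euclidean_space \<Rightarrow> 'b::euclidean_space"
  assumes "continuous_on UNIV h" and "compact K" and "\<And>x. x \<notin> K \<Longrightarrow> h x = 0"
  shows "integrable lborel h"
proof -
  obtain B where B: "B > 0" "\<And>x. norm (h x) \<le> B"
    using continuous_compact_support_bounded[OF assms] by metis
  have "integrable lborel (\<lambda>x. indicator K x *\<^sub>R B)"
    using assms(2) emeasure_bounded_finite[OF compact_imp_bounded[OF assms(2)]]
    by (intro integrable_scaleR_left integrable_real_indicator) (auto simp: borel_compact)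
  then show ?thesis
    by (rule Bochner_Integration.integrable_bound)
       (use assms B in \<open>auto simp: indicator_def intro: borel_measurable_continuous_onI\<close>)
qed

text \<open>By translation invariance every difference quotient of \<open>f\<close> in direction \<open>e\<close> has integral \<open>0\<close>.
  The quotients are bounded by the Lipschitz constant of \<open>f\<close> times \<open>|e|\<close>, vanish off a fixed ball, and
  converge to the directional derivative, so dominated convergence applies.\<close>

lemma integral_directional_derivative_zero:
  fixes f :: "'a::euclidean_space \<Rightarrow> real"
  assumes f: "C_on 1 UNIV f" and K: "compact (closure {x. f x \<noteq> 0})"
  shows "(\<integral>x. grad f x \<bullet> e \<partial>lborel) = 0"
proof -
  let ?K = "closure {x. f x \<noteq> 0}"
  define s where "s = (\<lambda>n x. (f (inverse (real (Suc n)) *\<^sub>R e + x) - f x) * real (Suc n))"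
  have int_f: "integrable lborel f"
    using integrable_continuous_compact_support[OF C1_continuous[OF f] K] zero_outside_support[of _ f]
    by blast
  obtain B where B: "B > 0" "\<And>x. norm (grad f x) \<le> B"
    using continuous_compact_support_bounded[OF C1_continuous_grad[OF f] K grad_zero_outside_support]
    by metis
  obtain R where R: "\<And>x. x \<in> ?K \<Longrightarrow> norm x \<le> R"
    using compact_imp_bounded[OF K] bounded_iff by blast
  let ?w = "\<lambda>x. indicator (cball (0::'a) (R + norm e)) x *\<^sub>R (B * norm e)"
  have zero: "(\<integral>x. s n x \<partial>lborel) = 0" for n
    unfolding s_def using lborel_integral_translate[OF int_f] int_f by simp
  have "(\<lambda>n. \<integral>x. s n x \<partial>lborel) \<longlonglongrightarrow> (\<integral>x. grad f x \<bullet> e \<partial>lborel)"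
  proof (rule integral_dominated_convergence)
    show "(\<lambda>x. grad f x \<bullet> e) \<in> borel_measurable lborel"
      by (simp, intro borel_measurable_continuous_onI continuous_intros C1_continuous_grad[OF f])
    have "continuous_on UNIV (\<lambda>x. f (c + x))" for c
      by (rule continuous_on_compose2[OF C1_continuous[OF f]]) (intro continuous_intros, simp)
    then have "continuous_on UNIV (s n)" for n
      unfolding s_def by (intro continuous_intros C1_continuous[OF f])
    then show "s n \<in> borel_measurable lborel" for n
      by (simp add: borel_measurable_continuous_onI)
    show "integrable lborel ?w"
      using emeasure_bounded_finite[of "cball 0 (R + norm e) :: 'a set"]
      by (intro integrable_scaleR_left integrable_real_indicator) auto
    show "AE x in lborel. (\<lambda>n. s n x) \<longlonglongrightarrow> grad f x \<bullet> e"
    proof (rule AE_I2)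
      fix x
      define T where "T = (\<lambda>t. f (x + t *\<^sub>R e))"
      have "(f has_derivative (\<lambda>h. grad f x \<bullet> h)) (at (x + 0 *\<^sub>R e))"
        using C1_has_derivative[OF f, of x] by simp
      then have "(T has_derivative (\<lambda>t. grad f x \<bullet> (t *\<^sub>R e))) (at 0)"
        unfolding T_def
        by (intro has_derivative_compose[where g = f and f = "\<lambda>t. x + t *\<^sub>R e"])
           (auto intro!: derivative_eq_intros)
      then have "(T has_real_derivative (grad f x \<bullet> e)) (at 0)"
        by (rule has_derivative_imp_has_field_derivative) simp
      then have "((\<lambda>h. (T (0 + h) - T 0) / h) \<longlongrightarrow> grad f x \<bullet> e) (at 0)"
        by (simp add: DERIV_def)
      moreover have "filterlim (\<lambda>n. inverse (real (Suc n))) (at 0) sequentially"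
        using LIMSEQ_inverse_real_of_nat by (auto simp: filterlim_at)
      ultimately have "(\<lambda>n. (T (0 + inverse (real (Suc n))) - T 0) / inverse (real (Suc n)))
          \<longlonglongrightarrow> grad f x \<bullet> e"
        by (rule filterlim_compose)
      then show "(\<lambda>n. s n x) \<longlonglongrightarrow> grad f x \<bullet> e"
        by (simp add: s_def T_def divide_inverse add.commute)
    qed
    show "AE x in lborel. norm (s n x) \<le> ?w x" for n
    proof (rule AE_I2)
      fix x
      let ?t = "inverse (real (Suc n))"
      have lip: "norm (f (?t *\<^sub>R e + x) - f x) \<le> B * norm ((?t *\<^sub>R e + x) - x)"
      proof (rule differentiable_bound[where S = UNIV and f' = "\<lambda>x h. grad f x \<bullet> h"])
        show "onorm (\<lambda>h. grad f y \<bullet> h) \<le> B" for y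
          by (rule onorm_le) (metis B(2) Cauchy_Schwarz_ineq2 mult_right_mono norm_ge_zero
              order_trans real_norm_def)
      qed (use C1_has_derivative[OF f] in auto)
      show "norm (s n x) \<le> ?w x"
      proof (cases "norm x \<le> R + norm e")
        case True
        have "norm (s n x) = norm (f (?t *\<^sub>R e + x) - f x) * real (Suc n)"
          by (simp add: s_def abs_mult)
        also have "\<dots> \<le> (B * norm ((?t *\<^sub>R e + x) - x)) * real (Suc n)"
          by (rule mult_right_mono[OF lip]) simp
        also have "\<dots> = B * norm e" by simp
        finally show ?thesis using True by simp
      next
        case False
        have "norm (?t *\<^sub>R e) \<le> norm e"
          by (simp add: mult_left_le_one_le inverse_le_1_iff)
        then have "norm (?t *\<^sub>R e + x) > R"
          using False norm_diff_triangle_ineq[of "?t *\<^sub>R e" x 0 0] norm_triangle_ineq4[of "?t *\<^sub>R e + x" "?t *\<^sub>R e"]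
          by simp
        moreover have "norm x > R" using False norm_ge_zero[of e] by linarith
        ultimately have "f (?t *\<^sub>R e + x) = 0" "f x = 0"
          using R zero_outside_support by (metis not_le)+
        then show ?thesis using B(1) by (simp add: s_def)
      qed
    qed
  qed
  then show ?thesis unfolding zero by (simp add: LIMSEQ_const_iff)
qed

lemma integral_lebesgue_on_eq_lborel:
  fixes h :: "'a::euclidean_space \<Rightarrow> 'b::euclidean_space"
  assumes "S \<in> sets lebesgue" and "h \<in> borel_measurable borel" and "\<And>x. x \<notin> S \<Longrightarrow> h x = 0"
  shows "(\<integral>x. h x \<partial>lebesgue_on S) = (\<integral>x. h x \<partial>lborel)"
proof -
  have "(\<integral>x. h x \<partial>lebesgue_on S) = (\<integral>x. indicator S x *\<^sub>R h x \<partial>lebesgue)"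
    using assms(1) by (subst integral_restrict_space) auto
  also have "(\<lambda>x. indicator S x *\<^sub>R h x) = h" using assms(3) by (auto simp: indicator_def)
  also have "(\<integral>x. h x \<partial>lebesgue) = (\<integral>x. h x \<partial>lborel)"
    using assms(2) by (intro integral_completion) simp
  finally show ?thesis .
qed

lemma integral_grad_inner_zero:
  fixes \<Omega> :: "'a::euclidean_space set"
  assumes "open \<Omega>" and f: "f \<in> C1_c \<Omega>"
  shows "(\<integral>x. grad f x \<bullet> e \<partial>lebesgue_on \<Omega>) = 0"
proof -
  have C: "C_on 1 UNIV f" and K: "compact (closure {x. f x \<noteq> 0})" "closure {x. f x \<noteq> 0} \<subseteq> \<Omega>"
    using f by (auto simp: C1_c_def compact_support_in_def)
  have "(\<integral>x. grad f x \<bullet> e \<partial>lebesgue_on \<Omega>) = (\<integral>x. grad f x \<bullet> e \<partial>lborel)"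
  proof (rule integral_lebesgue_on_eq_lborel)
    show "(\<lambda>x. grad f x \<bullet> e) \<in> borel_measurable borel"
      by (intro borel_measurable_continuous_onI continuous_intros C1_continuous_grad[OF C])
    show "x \<notin> \<Omega> \<Longrightarrow> grad f x \<bullet> e = 0" for x
      using grad_zero_outside_support[of x f] K(2) by (metis inner_zero_left subsetD)
  qed (use assms in simp)
  then show ?thesis using integral_directional_derivative_zero[OF C K(1)] by simp
qed

lemma finite_measure_bounded_open:
  assumes "open \<Omega>" and "bounded \<Omega>"
  shows "finite_measure (lebesgue_on (\<Omega>::'a::euclidean_space set))"
  by (rule finite_measure_lebesgue_on) (use assms in \<open>auto intro: lmeasurable_open\<close>)

lemma C1_c_measurable:
  assumes "\<phi> \<in> C1_c \<Omega>"
  shows "\<phi> \<in> borel_measurable (lebesgue_on S)" and "grad \<phi> \<in> borel_measurable (lebesgue_on S)"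
  using assms by (auto intro!: continuous_measurable_lebesgue_on C1_continuous C1_continuous_grad
      dest: C1_cD simp del: C_on.simps One_nat_def)

section \<open>Smooth bump functions on boxes\<close>

lemma C_on_SucI:
  assumes "\<And>x. (f has_derivative f' x) (at x)" and "\<And>h. C_on k UNIV (\<lambda>x. f' x h)"
  shows "C_on (Suc k) UNIV f"
proof -
  have "frechet_derivative f (at x) = f' x" for x
    using frechet_derivative_at[OF assms(1)] by simp
  then show ?thesis using assms by (auto simp: differentiable_def)
qed

lemma C_on_SucD:
  assumes "C_on (Suc k) UNIV f"
  shows "(f has_derivative frechet_derivative f (at x)) (at x)"
    and "C_on k UNIV (\<lambda>x. frechet_derivative f (at x) h)"
  using assms by (auto simp: frechet_derivative_works)

text \<open>Needed in the product rule, where one factor keeps its full order of smoothness while the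
  other is differentiated.\<close>

lemma C_on_Suc_imp_C_on: "C_on (Suc k) UNIV f \<Longrightarrow> C_on k UNIV f"
proof (induction k arbitrary: f)
  case 0
  then show ?case
    by (auto intro!: differentiable_imp_continuous_on simp: differentiable_on_def)
next
  case (Suc k)
  then show ?case by (metis C_on.simps(2))
qed

lemma C_on_const: "C_on k UNIV (\<lambda>x. c)"
  by (induction k arbitrary: c)
     (auto intro!: continuous_intros C_on_SucI simp del: C_on.simps(2) intro: has_derivative_const)

lemma C_on_add: "C_on k UNIV f \<Longrightarrow> C_on k UNIV g \<Longrightarrow> C_on k UNIV (\<lambda>x. f x + g x)"
proof (induction k arbitrary: f g)
  case 0
  then show ?case by (auto intro: continuous_intros)
next
  case (Suc k)
  show ?case
    by (rule C_on_SucI[OF has_derivative_add[OF C_on_SucD(1)[OF Suc.prems(1)] C_on_SucD(1)[OF Suc.prems(2)]]])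
       (intro Suc.IH C_on_SucD(2)[OF Suc.prems(1)] C_on_SucD(2)[OF Suc.prems(2)])
qed

lemma C_on_mult: "C_on k UNIV f \<Longrightarrow> C_on k UNIV g \<Longrightarrow> C_on k UNIV (\<lambda>x. f x * g x)"
proof (induction k arbitrary: f g)
  case 0
  then show ?case by (auto intro: continuous_intros)
next
  case (Suc k)
  show ?case
    by (rule C_on_SucI[OF has_derivative_mult[OF C_on_SucD(1)[OF Suc.prems(1)] C_on_SucD(1)[OF Suc.prems(2)]]])
       (intro C_on_add Suc.IH C_on_SucD(2)[OF Suc.prems(1)] C_on_SucD(2)[OF Suc.prems(2)]
         C_on_Suc_imp_C_on[OF Suc.prems(1)] C_on_Suc_imp_C_on[OF Suc.prems(2)])
qed

lemma C_on_prod: "(\<And>i. i \<in> I \<Longrightarrow> C_on k UNIV (f i)) \<Longrightarrow> C_on k UNIV (\<lambda>x. \<Prod>i\<in>I. f i x)"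
  by (induction I rule: infinite_finite_induct) (auto intro: C_on_const C_on_mult)

text \<open>The smooth function \<open>exp (- 1 / s)\<close> on the positive half-line is the case \<open>m = 0\<close>. The factors
  \<open>s\<^sup>-\<^sup>m\<close> are included because the derivative of each member of the family is a linear combination of
  later members; smoothness of all of them then follows by one induction on the order.\<close>

definition flat :: "nat \<Rightarrow> real \<Rightarrow> real" where
  "flat m s = (if s \<le> 0 then 0 else exp (- inverse s) * inverse s ^ m)"

lemma flat_tendsto_0: "(flat m \<longlongrightarrow> 0) (at 0)"
proof -
  have "((\<lambda>t::real. t ^ m / exp t) \<longlongrightarrow> 0) at_top" by (rule tendsto_power_div_exp_0)
  then have "((\<lambda>s. inverse s ^ m / exp (inverse s)) \<longlongrightarrow> (0::real)) (at_right 0)"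
    by (rule filterlim_compose[OF _ filterlim_inverse_at_top_right])
  moreover have "eventually (\<lambda>s. inverse s ^ m / exp (inverse s) = flat m s) (at_right 0)"
    by (auto simp: eventually_at_filter flat_def exp_minus field_simps)
  ultimately have "(flat m \<longlongrightarrow> 0) (at_right 0)" by (rule Lim_transform_eventually)
  moreover have "(flat m \<longlongrightarrow> 0) (at_left 0)"
    by (rule Lim_transform_eventually[OF tendsto_const])
       (auto simp: eventually_at_filter flat_def)
  ultimately show ?thesis by (simp add: filterlim_split_at)
qed

text \<open>The only delicate point is \<open>s = 0\<close>, where the difference quotient of \<open>flat m\<close> is \<open>flat (m + 1)\<close>.\<close>

lemma flat_has_derivative:
  "(flat m has_real_derivative (flat (m + 2) s - real m * flat (m + 1) s)) (at s)"
proof -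
  consider "s < 0" | "s = 0" | "s > 0" by linarith
  then show ?thesis
  proof cases
    case 1
    have "((\<lambda>s. 0) has_real_derivative 0) (at s)" by simp
    then have "(flat m has_real_derivative 0) (at s)"
      by (rule has_field_derivative_transform_within_open[where S = "{..<0}"])
         (use 1 in \<open>auto simp: flat_def\<close>)
    then show ?thesis using 1 by (simp add: flat_def)
  next
    case 2
    have "((\<lambda>h. (flat m (0 + h) - flat m 0) / h) \<longlongrightarrow> 0) (at 0)"
      by (rule Lim_transform_eventually[OF flat_tendsto_0[of "Suc m"]])
         (auto simp: eventually_at_filter flat_def field_simps)
    then show ?thesis using 2 by (simp add: DERIV_def flat_def)
  next
    case 3
    have inv: "((\<lambda>s. inverse s) has_real_derivative - (inverse s ^ 2)) (at s)"
      using 3 DERIV_inverse[of s] by (simp add: numeral_2_eq_2)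
    have "((\<lambda>s. inverse s ^ m) has_real_derivative (- real m * inverse s ^ (m + 1))) (at s)"
      using DERIV_power[OF inv, of m] by (cases m) (simp_all add: power2_eq_square algebra_simps)
    moreover have "((\<lambda>s. exp (- inverse s)) has_real_derivative exp (- inverse s) * inverse s ^ 2) (at s)"
      using DERIV_fun_exp[OF DERIV_minus[OF inv]] by simp
    ultimately have "((\<lambda>s. exp (- inverse s) * inverse s ^ m) has_real_derivative
        (exp (- inverse s) * (- real m * inverse s ^ (m + 1))
          + exp (- inverse s) * inverse s ^ 2 * inverse s ^ m)) (at s)"
      by (intro DERIV_mult')
    also have "exp (- inverse s) * (- real m * inverse s ^ (m + 1))
          + exp (- inverse s) * inverse s ^ 2 * inverse s ^ m
        = flat (m + 2) s - real m * flat (m + 1) s"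
      using 3 by (simp add: flat_def power_add power2_eq_square)
    finally have "((\<lambda>s. exp (- inverse s) * inverse s ^ m) has_real_derivative
        (flat (m + 2) s - real m * flat (m + 1) s)) (at s)" .
    then show ?thesis
      by (rule has_field_derivative_transform_within_open[where S = "{0<..}"])
         (use 3 in \<open>auto simp: flat_def\<close>)
  qed
qed

lemma C_on_flat:
  fixes b :: "'a::euclidean_space"
  shows "C_on k UNIV (\<lambda>x. flat m (\<alpha> * (x \<bullet> b) + \<beta>))"
proof (induction k arbitrary: m)
  case 0
  have "continuous_on UNIV (flat m)"
    by (intro continuous_at_imp_continuous_on ballI DERIV_isCont[OF flat_has_derivative])
  then show ?case
    by (auto intro!: continuous_on_compose2[of UNIV "flat m"] continuous_intros)
next
  case (Suc k)
  let ?f' = "\<lambda>x h. (flat (m + 2) (\<alpha> * (x \<bullet> b) + \<beta>) + (- real m) * flat (m + 1) (\<alpha> * (x \<bullet> b) + \<beta>))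
    * (\<alpha> * (h \<bullet> b))"
  have lin: "((\<lambda>x. \<alpha> * (x \<bullet> b) + \<beta>) has_derivative (\<lambda>h. \<alpha> * (h \<bullet> b))) (at x)" for x
    by (auto intro!: derivative_eq_intros)
  have "((\<lambda>x. flat m (\<alpha> * (x \<bullet> b) + \<beta>)) has_derivative ?f' x) (at x)" for x
    using has_derivative_compose[OF lin flat_has_derivative[unfolded has_field_derivative_def]]
    by simp
  then show ?case
    by (rule C_on_SucI) (intro C_on_mult C_on_add C_on_const Suc.IH)
qed

lemma flat_0_bounds: "0 \<le> flat 0 s" "flat 0 s \<le> 1"
  by (auto simp: flat_def)

lemma flat_0_tendsto: "(\<lambda>n. flat 0 (real (Suc n) * t)) \<longlonglongrightarrow> (if t > 0 then 1 else 0)"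
proof (cases "t > 0")
  case True
  have "(\<lambda>n. exp (- (inverse (real (Suc n)) * inverse t))) \<longlonglongrightarrow> exp (- (0 * inverse t))"
    by (intro tendsto_intros LIMSEQ_inverse_real_of_nat)
  moreover have "flat 0 (real (Suc n) * t) = exp (- (inverse (real (Suc n)) * inverse t))" for n
    using True by (simp add: flat_def inverse_mult_distrib not_le del: of_nat_Suc)
  ultimately show ?thesis using True by simp
next
  case False
  then have "real (Suc n) * t \<le> 0" for n by (simp add: mult_nonneg_nonpos del: of_nat_Suc)
  then show ?thesis using False by (simp add: flat_def del: of_nat_Suc)
qed

text \<open>The parameter \<open>t\<close> steepens the bump: for \<open>t \<rightarrow> \<infinity>\<close> it converges boundedly to the indicator function
  of the open box.\<close>

definition box_bump :: "'a::euclidean_space \<Rightarrow> 'a \<Rightarrow> real \<Rightarrow> 'a \<Rightarrow> real" where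
  "box_bump c d t x = (\<Prod>b\<in>Basis. flat 0 (t * (x \<bullet> b - c \<bullet> b)) * flat 0 (t * (d \<bullet> b - x \<bullet> b)))"

lemma box_bump_bounds: "0 \<le> box_bump c d t x" "box_bump c d t x \<le> 1"
  unfolding box_bump_def
  by (auto intro!: prod_nonneg prod_le_1 mult_le_one mult_nonneg_nonneg flat_0_bounds)

lemma box_bump_zero: "t > 0 \<Longrightarrow> x \<notin> box c d \<Longrightarrow> box_bump c d t x = 0"
  unfolding box_bump_def
  by (rule prod_zero) (auto simp: mem_box flat_def mult_nonneg_nonpos not_less intro!: bexI)

lemma box_bump_tendsto: "(\<lambda>n. box_bump c d (real (Suc n)) x) \<longlonglongrightarrow> indicator (box c d) x"
proof -
  have "(\<lambda>n. box_bump c d (real (Suc n)) x) \<longlonglongrightarrow>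
      (\<Prod>b\<in>Basis. (if x \<bullet> b - c \<bullet> b > 0 then 1 else 0) * (if d \<bullet> b - x \<bullet> b > 0 then 1 else 0 :: real))"
    unfolding box_bump_def by (intro tendsto_prod tendsto_mult flat_0_tendsto)
  also have "(\<Prod>b\<in>Basis. (if x \<bullet> b - c \<bullet> b > 0 then 1 else 0) * (if d \<bullet> b - x \<bullet> b > 0 then 1 else 0 :: real))
      = indicator (box c d) x"
    by (auto simp: indicator_def mem_box intro!: prod_zero bexI)
  finally show ?thesis .
qed

lemma box_bump_Cinf_c:
  assumes "t > 0" and "cbox c d \<subseteq> \<Omega>"
  shows "box_bump c d t \<in> Cinf_c \<Omega>"
proof -
  have "C_on k UNIV (box_bump c d t)" for k
  proof -
    have "box_bump c d t = (\<lambda>x. \<Prod>b\<in>Basis. flat 0 (t * (x \<bullet> b) + (- t * (c \<bullet> b)))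
        * flat 0 (- t * (x \<bullet> b) + t * (d \<bullet> b)))"
      by (simp add: box_bump_def algebra_simps fun_eq_iff)
    then show ?thesis by (simp only:) (intro C_on_prod C_on_mult C_on_flat)
  qed
  moreover have "compact_support_in \<Omega> (box_bump c d t)"
  proof -
    have "{x. box_bump c d t x \<noteq> 0} \<subseteq> cbox c d"
      using box_bump_zero[OF assms(1)] box_subset_cbox by blast
    then have "closure {x. box_bump c d t x \<noteq> 0} \<subseteq> cbox c d"
      by (rule closure_minimal) (rule closed_cbox)
    then show ?thesis
      using assms(2) unfolding compact_support_in_def compact_eq_bounded_closed
      by (blast intro: bounded_subset bounded_cbox closed_closure)
  qed
  ultimately show ?thesis by (simp add: Cinf_c_def)
qed

section \<open>The fundamental lemma of the calculus of variations\<close>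

lemma L1_loc_integrable_indicator:
  fixes d :: "'a::euclidean_space \<Rightarrow> 'b::euclidean_space"
  assumes "L1_loc \<Omega> d" and "compact K" and "K \<subseteq> \<Omega>" and "\<Omega> \<in> sets lebesgue"
  shows "integrable (lebesgue_on \<Omega>) (\<lambda>x. indicator K x *\<^sub>R d x)"
    and "integrable lebesgue (\<lambda>x. indicator K x *\<^sub>R d x)"
proof -
  have "integrable (lebesgue_on K) d" using assms by (auto simp: L1_loc_def)
  then show *: "integrable lebesgue (\<lambda>x. indicator K x *\<^sub>R d x)"
    using assms(2) by (subst (asm) integrable_restrict_space) (auto simp: borel_compact)
  have "(\<lambda>x. indicator \<Omega> x *\<^sub>R indicator K x *\<^sub>R d x) = (\<lambda>x. indicator K x *\<^sub>R d x)"
    using assms(3) by (auto simp: fun_eq_iff split: split_indicator)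
  with * show "integrable (lebesgue_on \<Omega>) (\<lambda>x. indicator K x *\<^sub>R d x)"
    using assms(4) by (subst integrable_restrict_space) auto
qed

lemma integral_box_zero:
  fixes d :: "'a::euclidean_space \<Rightarrow> 'b::euclidean_space"
  assumes "open \<Omega>" and d: "L1_loc \<Omega> d"
    and zero: "\<And>\<phi>. \<phi> \<in> Cinf_c \<Omega> \<Longrightarrow> (\<integral>x. \<phi> x *\<^sub>R d x \<partial>lebesgue_on \<Omega>) = 0"
    and sub: "cbox c e \<subseteq> \<Omega>"
  shows "(\<integral>x. indicator (box c e) x *\<^sub>R d x \<partial>lebesgue) = 0"
proof -
  have S: "\<Omega> \<in> sets lebesgue" using assms(1) by simp
  have d_m: "d \<in> borel_measurable (lebesgue_on \<Omega>)" using d by (simp add: L1_loc_def)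
  have "(\<lambda>n. \<integral>x. box_bump c e (real (Suc n)) x *\<^sub>R d x \<partial>lebesgue_on \<Omega>)
      \<longlonglongrightarrow> (\<integral>x. indicator (box c e) x *\<^sub>R d x \<partial>lebesgue_on \<Omega>)"
  proof (rule integral_dominated_convergence)
    show "integrable (lebesgue_on \<Omega>) (\<lambda>x. norm (indicator (cbox c e) x *\<^sub>R d x))"
      by (intro integrable_norm L1_loc_integrable_indicator d sub S compact_cbox)
    have "indicator (box c e) \<in> borel_measurable (lebesgue_on \<Omega>)"
      by (intro measurable_restrict_space1 measurable_completion) simp
    then show "(\<lambda>x. indicator (box c e) x *\<^sub>R d x) \<in> borel_measurable (lebesgue_on \<Omega>)"
      using d_m by (rule borel_measurable_scaleR)
    show "(\<lambda>x. box_bump c e (real (Suc n)) x *\<^sub>R d x) \<in> borel_measurable (lebesgue_on \<Omega>)" for n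
      using d_m C1_c_measurable(1)[OF Cinf_c_imp_C1_c[OF box_bump_Cinf_c[OF _ sub]]]
      by (intro borel_measurable_scaleR) auto
    show "AE x in lebesgue_on \<Omega>. (\<lambda>n. box_bump c e (real (Suc n)) x *\<^sub>R d x)
        \<longlonglongrightarrow> indicator (box c e) x *\<^sub>R d x"
      by (intro AE_I2 tendsto_scaleR box_bump_tendsto tendsto_const)
    show "AE x in lebesgue_on \<Omega>. norm (box_bump c e (real (Suc n)) x *\<^sub>R d x)
        \<le> norm (indicator (cbox c e) x *\<^sub>R d x)" for n
    proof (rule AE_I2)
      fix x
      show "norm (box_bump c e (real (Suc n)) x *\<^sub>R d x) \<le> norm (indicator (cbox c e) x *\<^sub>R d x)"
        using box_bump_bounds[of c e "real (Suc n)" x] box_bump_zero[of "real (Suc n)" x c e]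
          subsetD[OF box_subset_cbox, of x c e]
        by (cases "x \<in> box c e") (auto intro: mult_left_le_one_le simp del: of_nat_Suc)
    qed
  qed
  moreover have "(\<integral>x. box_bump c e (real (Suc n)) x *\<^sub>R d x \<partial>lebesgue_on \<Omega>) = 0" for n
    by (rule zero[OF box_bump_Cinf_c[OF _ sub]]) simp
  ultimately have "(\<integral>x. indicator (box c e) x *\<^sub>R d x \<partial>lebesgue_on \<Omega>) = 0"
    by (simp add: LIMSEQ_const_iff)
  also have "(\<integral>x. indicator (box c e) x *\<^sub>R d x \<partial>lebesgue_on \<Omega>)
      = (\<integral>x. indicator \<Omega> x *\<^sub>R indicator (box c e) x *\<^sub>R d x \<partial>lebesgue)"
    using S by (subst integral_restrict_space) auto
  also have "(\<lambda>x. indicator \<Omega> x *\<^sub>R indicator (box c e) x *\<^sub>R d x) = (\<lambda>x. indicator (box c e) x *\<^sub>R d x)"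
    using sub box_subset_cbox[of c e] by (auto simp: fun_eq_iff split: split_indicator)
  finally show ?thesis by simp
qed

text \<open>The sets over which \<open>F\<close> integrates to \<open>0\<close> form a Dynkin system, by the hypothesis on the total
  integral, and contain the intersection-stable generator of open boxes. So they comprise all Borel
  sets and, up to null sets, all Lebesgue measurable sets.\<close>

lemma AE_zero_if_box_integrals_zero:
  fixes F :: "'a::euclidean_space \<Rightarrow> 'b::euclidean_space"
  assumes F: "integrable lebesgue F" and total: "integral\<^sup>L lebesgue F = 0"
    and box: "\<And>a b. set_lebesgue_integral lebesgue (box a b) F = 0"
  shows "AE x in lebesgue. F x = 0"
proof (rule sigma_finite_measure.density_zero[OF _ F])
  show "sigma_finite_measure (lebesgue :: 'a measure)"
  proof
    obtain A :: "'a set set" where "countable A" "A \<subseteq> sets lborel" "\<Union>A = space lborel"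
        "\<forall>a\<in>A. emeasure lborel a \<noteq> \<infinity>"
      using lborel.sigma_finite_countable by metis
    then show "\<exists>A :: 'a set set. countable A \<and> A \<subseteq> sets lebesgue \<and> \<Union>A = space lebesgue
        \<and> (\<forall>a\<in>A. emeasure lebesgue a \<noteq> \<infinity>)"
      by (intro exI[of _ A]) auto
  qed
  have int: "set_integrable lebesgue A F" if "A \<in> sets lebesgue" for A
    unfolding set_integrable_def using F that by (rule integrable_mult_indicator[rotated])
  have borel: "set_lebesgue_integral lebesgue A F = 0" if "A \<in> sets borel" for A
  proof -
    have "A \<in> sigma_sets UNIV (range (\<lambda>(a, b). box a b :: 'a set))"
      using that by (simp add: borel_eq_box)
    then show ?thesis
    proof (rule sigma_sets_induct_disjoint[rotated 2])
      show "Int_stable (range (\<lambda>(a, b). box a b :: 'a set))"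
        by (auto simp: Int_stable_def box_Int_box)
    next
      fix A assume "A \<in> sigma_sets UNIV (range (\<lambda>(a, b). box a b :: 'a set))"
        and A0: "set_lebesgue_integral lebesgue A F = 0"
      then have "A \<in> sets borel" by (simp add: borel_eq_box)
      then have A: "A \<in> sets lebesgue" by simp
      have "set_lebesgue_integral lebesgue (UNIV - A) F
          = (\<integral>x. F x - indicator A x *\<^sub>R F x \<partial>lebesgue)"
        unfolding set_lebesgue_integral_def
        by (rule Bochner_Integration.integral_cong) (auto simp: indicator_def)
      also have "\<dots> = 0"
        using F int[OF A] total A0 by (simp add: set_lebesgue_integral_def set_integrable_def)
      finally show "set_lebesgue_integral lebesgue (UNIV - A) F = 0" .
    next
      fix A :: "nat \<Rightarrow> 'a set"
      assume disj: "disjoint_family A"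
        and A: "range A \<subseteq> sigma_sets UNIV (range (\<lambda>(a, b). box a b :: 'a set))"
        and A0: "\<And>i. set_lebesgue_integral lebesgue (A i) F = 0"
      have "A i \<in> sets borel" for i
        using A by (auto simp: borel_eq_box)
      then have m: "A i \<in> sets lebesgue" for i by simp
      have "set_lebesgue_integral lebesgue (\<Union>i. A i) F
          = (\<Sum>i. set_lebesgue_integral lebesgue (A i) F)"
        by (rule lebesgue_integral_countable_add)
           (use m disj int in \<open>auto simp: disjoint_family_on_def\<close>)
      then show "set_lebesgue_integral lebesgue (\<Union>i. A i) F = 0" using A0 by simp
    qed (use box in \<open>auto simp: set_lebesgue_integral_def\<close>)
  qed
  fix A :: "'a set" assume "A \<in> sets lebesgue"
  then obtain S N N' where A: "A = S \<union> N" "N \<subseteq> N'" "N' \<in> null_sets lborel" "S \<in> sets lborel"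
    by (rule sets_completionE)
  have "AE x in lborel. x \<notin> N'" using A(3) by (rule AE_not_in)
  then have "AE x in lebesgue. x \<in> A \<longleftrightarrow> x \<in> S"
    using A(1,2) by (auto intro!: AE_completion elim: eventually_mono)
  then have "set_lebesgue_integral lebesgue A F = set_lebesgue_integral lebesgue S F"
    using \<open>A \<in> sets lebesgue\<close> A(4) F int unfolding set_lebesgue_integral_def set_integrable_def
    by (intro integral_cong_AE) (auto simp: indicator_def elim: eventually_mono intro: borel_measurable_integrable)
  then show "set_lebesgue_integral lebesgue A F = 0" using borel A(4) by simp
qed

text \<open>Bumps give a vanishing integral over every box whose closure lies in \<open>\<Omega>\<close>, hence \<open>d = 0\<close> almost
  everywhere on such a box; countably many of them cover \<open>\<Omega>\<close>.\<close>

lemma fundamental_lemma_calculus_of_variations: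
  fixes d :: "'a::euclidean_space \<Rightarrow> 'b::euclidean_space"
  assumes \<Omega>: "open \<Omega>" and d: "L1_loc \<Omega> d"
    and zero: "\<And>\<phi>. \<phi> \<in> Cinf_c \<Omega> \<Longrightarrow> (\<integral>x. \<phi> x *\<^sub>R d x \<partial>lebesgue_on \<Omega>) = 0"
  shows "AE x in lebesgue_on \<Omega>. d x = 0"
proof -
  have S: "\<Omega> \<in> sets lebesgue" using \<Omega> by simp
  have on_cbox: "AE x in lebesgue. x \<in> cbox c e \<longrightarrow> d x = 0" if sub: "cbox c e \<subseteq> \<Omega>" for c e
  proof -
    \<comment> \<open>Cutting off with the open box keeps the intersection with any other open box an open box
      whose closure is still in \<open>\<Omega>\<close>; the boundary is a null set.\<close>
    let ?F = "\<lambda>x. indicator (box c e) x *\<^sub>R d x"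
    have "integrable lebesgue (\<lambda>x. indicator (cbox c e) x *\<^sub>R d x)"
      by (intro L1_loc_integrable_indicator(2)[OF d compact_cbox sub S])
    then have "integrable lebesgue (\<lambda>x. indicator (box c e) x *\<^sub>R indicator (cbox c e) x *\<^sub>R d x)"
      by (rule integrable_mult_indicator[rotated]) simp
    moreover have "(\<lambda>x. indicator (box c e) x *\<^sub>R indicator (cbox c e) x *\<^sub>R d x) = ?F"
      using box_subset_cbox[of c e] by (auto simp: fun_eq_iff split: split_indicator)
    ultimately have F: "integrable lebesgue ?F" by simp
    have "AE x in lebesgue. ?F x = 0"
    proof (rule AE_zero_if_box_integrals_zero[OF F])
      show "integral\<^sup>L lebesgue ?F = 0"
        by (rule integral_box_zero[OF \<Omega> d zero sub])
      fix a b
      obtain c' e' where ce: "box a b \<inter> box c e = box c' e'" "cbox c' e' \<subseteq> cbox c e"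
      proof (cases "box a b \<inter> box c e = {}")
        case True
        obtain i :: 'a where "i \<in> Basis" using nonempty_Basis by blast
        then have "box One 0 = ({} :: 'a set)" "cbox One 0 = ({} :: 'a set)"
          by (auto simp: box_eq_empty intro!: bexI[of _ i])
        \<comment> \<open>The empty intersection needs endpoints whose closed box is empty as well.\<close>
        then show ?thesis using that[of One 0] True by simp
      next
        case False
        have "cbox (\<Sum>i\<in>Basis. max (a \<bullet> i) (c \<bullet> i) *\<^sub>R i) (\<Sum>i\<in>Basis. min (b \<bullet> i) (e \<bullet> i) *\<^sub>R i)
            \<subseteq> cbox c e"
          by (auto simp: mem_box)
        then show ?thesis by (rule that[OF box_Int_box])
      qed
      have "set_lebesgue_integral lebesgue (box a b) ?F
          = (\<integral>x. indicator (box c' e') x *\<^sub>R d x \<partial>lebesgue)"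
        unfolding set_lebesgue_integral_def ce(1)[symmetric]
        by (rule Bochner_Integration.integral_cong) (auto simp: indicator_def)
      also have "\<dots> = 0"
        by (rule integral_box_zero[OF \<Omega> d zero]) (use ce(2) sub in auto)
      finally show "set_lebesgue_integral lebesgue (box a b) ?F = 0" .
    qed
    moreover have "AE x in lebesgue. x \<notin> cbox c e - box c e"
      using negligible_frontier_interval[of c e] by (intro AE_not_in) (simp add: negligible_iff_null_sets)
    ultimately show ?thesis by eventually_elim (auto simp: indicator_def split: if_splits)
  qed
  obtain \<D> where D: "countable \<D>" "\<D> \<subseteq> Pow \<Omega>" "\<And>X. X \<in> \<D> \<Longrightarrow> \<exists>a b. X = cbox a b" "\<Union>\<D> = \<Omega>"
    using open_countable_Union_open_cbox[OF \<Omega>] by metis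
  have "AE x in lebesgue. x \<in> X \<longrightarrow> d x = 0" if "X \<in> \<D>" for X
    using D(2,3) that on_cbox by blast
  then have "AE x in lebesgue. \<forall>X\<in>\<D>. x \<in> X \<longrightarrow> d x = 0"
    by (subst AE_ball_countable[OF D(1)]) blast
  then show ?thesis
    using S D(4) by (subst AE_restrict_space_iff) (auto elim!: eventually_mono)
qed

lemma L1_loc_integrable_test:
  fixes d :: "'a::euclidean_space \<Rightarrow> 'b::euclidean_space"
  assumes "open \<Omega>" and d: "L1_loc \<Omega> d" and \<phi>: "\<phi> \<in> C1_c \<Omega>"
  shows "integrable (lebesgue_on \<Omega>) (\<lambda>x. \<phi> x *\<^sub>R d x)"
proof -
  let ?K = "closure {x. \<phi> x \<noteq> 0}"
  have K: "compact ?K" "?K \<subseteq> \<Omega>" using \<phi> by (auto simp: C1_c_def compact_support_in_def)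
  obtain B where B: "B > 0" "\<And>x. \<bar>\<phi> x\<bar> \<le> B" using C1_c_bounded[OF \<phi>] by metis
  have "integrable (lebesgue_on \<Omega>) (\<lambda>x. B *\<^sub>R (indicator ?K x *\<^sub>R d x))"
    using assms(1) by (intro integrable_scaleR_right L1_loc_integrable_indicator[OF d K]) simp
  then show ?thesis
  proof (rule Bochner_Integration.integrable_bound)
    show "(\<lambda>x. \<phi> x *\<^sub>R d x) \<in> borel_measurable (lebesgue_on \<Omega>)"
      using d C1_c_measurable(1)[OF \<phi>] by (intro borel_measurable_scaleR) (auto simp: L1_loc_def)
    show "AE x in lebesgue_on \<Omega>. norm (\<phi> x *\<^sub>R d x) \<le> norm (B *\<^sub>R (indicator ?K x *\<^sub>R d x))"
    proof (rule AE_I2)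
      fix x
      show "norm (\<phi> x *\<^sub>R d x) \<le> norm (B *\<^sub>R (indicator ?K x *\<^sub>R d x))"
        using B zero_outside_support[of x \<phi>]
        by (cases "x \<in> ?K") (auto intro!: mult_right_mono)
    qed
  qed
qed

lemma L1_loc_diff:
  assumes "L1_loc \<Omega> d" and "L1_loc \<Omega> e"
  shows "L1_loc \<Omega> (\<lambda>x. d x - e x)"
  using assms by (auto simp: L1_loc_def)

lemma weak_gradient_unique:
  assumes "open \<Omega>" and g: "has_weak_gradient \<Omega> u g" and h: "has_weak_gradient \<Omega> u h"
  shows "AE x in lebesgue_on \<Omega>. g x = h x"
proof -
  have Lg: "L1_loc \<Omega> g" and Lh: "L1_loc \<Omega> h" using g h by (auto simp: has_weak_gradient_def)
  have "AE x in lebesgue_on \<Omega>. g x - h x = 0"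
  proof (rule fundamental_lemma_calculus_of_variations[OF assms(1) L1_loc_diff[OF Lg Lh]])
    fix \<phi> assume \<phi>: "\<phi> \<in> Cinf_c \<Omega>"
    note int = L1_loc_integrable_test[OF assms(1) _ Cinf_c_imp_C1_c[OF \<phi>]]
    have "(\<integral>x. \<phi> x *\<^sub>R (g x - h x) \<partial>lebesgue_on \<Omega>)
        = (\<integral>x. \<phi> x *\<^sub>R g x \<partial>lebesgue_on \<Omega>) - (\<integral>x. \<phi> x *\<^sub>R h x \<partial>lebesgue_on \<Omega>)"
      using int[OF Lg] int[OF Lh] by (simp add: scaleR_diff_right)
    also have "\<dots> = 0" using g h \<phi> by (simp add: has_weak_gradient_def)
    finally show "(\<integral>x. \<phi> x *\<^sub>R (g x - h x) \<partial>lebesgue_on \<Omega>) = 0" .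
  qed
  then show ?thesis by simp
qed

lemma integrable_bounded_open:
  fixes h :: "'a::euclidean_space \<Rightarrow> 'b::euclidean_space"
  assumes "open \<Omega>" and "bounded \<Omega>" and "h \<in> borel_measurable (lebesgue_on \<Omega>)"
    and "\<And>x. norm (h x) \<le> B"
  shows "integrable (lebesgue_on \<Omega>) h"
  using finite_measure.integrable_const_bound[OF finite_measure_bounded_open[OF assms(1,2)]] assms(3,4)
  by (metis (no_types, lifting) AE_I2)

lemma integrable_continuous_compact_support_on:
  fixes h :: "'a::euclidean_space \<Rightarrow> 'b::euclidean_space"
  assumes "open \<Omega>" and "bounded \<Omega>" and "continuous_on UNIV h"
    and "compact K" and "\<And>x. x \<notin> K \<Longrightarrow> h x = 0"
  shows "integrable (lebesgue_on \<Omega>) h"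
  using continuous_compact_support_bounded[OF assms(3-5)]
    integrable_bounded_open[OF assms(1,2) continuous_measurable_lebesgue_on[OF assms(3)]]
  by metis

lemma integral_grad_zero:
  fixes \<Omega> :: "'a::euclidean_space set"
  assumes "open \<Omega>" and "bounded \<Omega>" and f: "f \<in> C1_c \<Omega>"
  shows "(\<integral>x. grad f x \<partial>lebesgue_on \<Omega>) = 0"
proof (rule euclidean_eqI)
  fix e :: 'a
  obtain B where "\<And>x. norm (grad f x) \<le> B" using C1_c_bounded[OF f] by metis
  then have "integrable (lebesgue_on \<Omega>) (grad f)"
    by (rule integrable_bounded_open[OF assms(1,2) C1_c_measurable(2)[OF f]])
  then have "(\<integral>x. grad f x \<partial>lebesgue_on \<Omega>) \<bullet> e = (\<integral>x. grad f x \<bullet> e \<partial>lebesgue_on \<Omega>)"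
    by simp
  then show "(\<integral>x. grad f x \<partial>lebesgue_on \<Omega>) \<bullet> e = 0 \<bullet> e"
    using integral_grad_inner_zero[OF assms(1) f] by simp
qed

lemma C1_mult_C1_c:
  assumes "C_on 1 UNIV f" and "\<eta> \<in> C1_c \<Omega>"
  shows "(\<lambda>x. f x * \<eta> x) \<in> C1_c \<Omega>"
  unfolding C1_c_def mem_Collect_eq
proof
  show "C_on 1 UNIV (\<lambda>x. f x * \<eta> x)" by (rule C1_mult(1)[OF assms(1) C1_cD[OF assms(2)]])
  have "compact_support_in \<Omega> \<eta>" using assms(2) by (simp add: C1_c_def)
  then show "compact_support_in \<Omega> (\<lambda>x. f x * \<eta> x)"
    by (rule compact_support_in_mono) simp
qed

lemma integration_by_parts_test:
  fixes \<Omega> :: "'a::euclidean_space set"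
  assumes "open \<Omega>" and "bounded \<Omega>" and f: "C_on 1 UNIV f" and \<eta>: "\<eta> \<in> C1_c \<Omega>"
  shows "(\<integral>x. f x *\<^sub>R grad \<eta> x \<partial>lebesgue_on \<Omega>) = - (\<integral>x. \<eta> x *\<^sub>R grad f x \<partial>lebesgue_on \<Omega>)"
proof -
  have K: "compact (closure {x. \<eta> x \<noteq> 0})" using \<eta> by (simp add: C1_c_def compact_support_in_def)
  have "integrable (lebesgue_on \<Omega>) (\<lambda>x. f x *\<^sub>R grad \<eta> x)"
    by (rule integrable_continuous_compact_support_on[OF assms(1,2) _ K])
       (intro continuous_intros C1_continuous[OF f] C1_continuous_grad[OF C1_cD[OF \<eta>]],
        metis grad_zero_outside_support scaleR_zero_right)
  moreover have "integrable (lebesgue_on \<Omega>) (\<lambda>x. \<eta> x *\<^sub>R grad f x)"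
    by (rule integrable_continuous_compact_support_on[OF assms(1,2) _ K])
       (intro continuous_intros C1_continuous[OF C1_cD[OF \<eta>]] C1_continuous_grad[OF f],
        metis zero_outside_support[of _ \<eta>] scaleR_zero_left)
  ultimately have "(\<integral>x. f x *\<^sub>R grad \<eta> x \<partial>lebesgue_on \<Omega>) + (\<integral>x. \<eta> x *\<^sub>R grad f x \<partial>lebesgue_on \<Omega>)
      = (\<integral>x. grad (\<lambda>x. f x * \<eta> x) x \<partial>lebesgue_on \<Omega>)"
    by (simp add: C1_mult(2)[OF f C1_cD[OF \<eta>]])
  also have "\<dots> = 0" by (rule integral_grad_zero[OF assms(1,2) C1_mult_C1_c[OF f \<eta>]])
  finally show ?thesis by (rule add_eq_0_iff2[THEN iffD1])
qed

section \<open>Poincare's inequality for test functions\<close>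

text \<open>A form of Young's inequality without sharp constants: the first term on the right dominates
  when \<open>b \<le> \<delta> a\<close>, the second when \<open>b > \<delta> a\<close>. It takes the place of Hoelder's inequality throughout.\<close>

lemma powr_Young:
  fixes a b \<delta> p :: real
  assumes "a \<ge> 0" "b \<ge> 0" "\<delta> > 0" "p \<ge> 1"
  shows "a powr (p - 1) * b \<le> \<delta> * a powr p + \<delta> powr (1 - p) * b powr p"
proof (cases "b \<le> \<delta> * a")
  case True
  have "a powr (p - 1) * b \<le> a powr (p - 1) * (\<delta> * a)"
    using True by (intro mult_left_mono) auto
  also have "\<dots> = \<delta> * a powr p"
    using powr_mult_base[OF assms(1), of "p - 1"] by (simp add: mult_ac)
  finally show ?thesis by (simp add: add_increasing2)
next
  case False
  then have "a < b / \<delta>" and b: "b > 0"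
    using assms by (auto simp: field_simps intro: le_less_trans mult_nonneg_nonneg)
       (smt (verit) mult_nonneg_nonneg)
  then have "a powr (p - 1) * b \<le> (b / \<delta>) powr (p - 1) * b"
    using assms by (intro mult_right_mono powr_mono2) auto
  also have "\<dots> = \<delta> powr (1 - p) * b powr p"
  proof -
    have "(b / \<delta>) powr (p - 1) * b = (b * b powr (p - 1)) / \<delta> powr (p - 1)"
      using b assms by (simp add: powr_divide)
    then show ?thesis
      using b powr_mult_base[of b "p - 1"] powr_minus[of \<delta> "p - 1"] by (simp add: divide_inverse)
  qed
  finally show ?thesis using assms by (simp add: add_increasing)
qed

lemma powr_add_le:
  fixes a b p :: real
  assumes "a \<ge> 0" "b \<ge> 0" "p \<ge> 1"
  shows "(a + b) powr p \<le> 2 powr p * (a powr p + b powr p)"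
proof -
  have "(a + b) powr p \<le> (2 * max a b) powr p"
    using assms by (intro powr_mono2) auto
  also have "\<dots> = 2 powr p * max a b powr p" using assms by (simp add: powr_mult)
  also have "\<dots> \<le> 2 powr p * (a powr p + b powr p)"
    by (intro mult_left_mono) (auto simp: max_def)
  finally show ?thesis .
qed

text \<open>Writing the derivative with positive and negative parts instead of \<open>sgn\<close> makes its continuity
  at \<open>0\<close> evident.\<close>

lemma abs_powr_has_derivative:
  fixes p s :: real
  assumes "p > 1"
  shows "((\<lambda>s. \<bar>s\<bar> powr p) has_real_derivative p * (max s 0 powr (p - 1) - max (- s) 0 powr (p - 1))) (at s)"
proof -
  consider "s > 0" | "s < 0" | "s = 0" by linarith
  then show ?thesis
  proof cases
    case 1
    have "((\<lambda>s. s powr p) has_real_derivative p * s powr (p - 1)) (at s)"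
      using 1 by (rule has_real_derivative_powr)
    then have "((\<lambda>s. \<bar>s\<bar> powr p) has_real_derivative p * s powr (p - 1)) (at s)"
      by (rule has_field_derivative_transform_within_open[where S = "{0<..}"]) (use 1 in auto)
    then show ?thesis using 1 by simp
  next
    case 2
    have "((\<lambda>s. s powr p) has_real_derivative p * (- s) powr (p - 1)) (at (- s))"
      using 2 by (intro has_real_derivative_powr) simp
    then have "((\<lambda>s. (- s) powr p) has_real_derivative p * (- s) powr (p - 1) * (- 1)) (at s)"
      by (rule DERIV_chain2) (auto intro!: derivative_eq_intros)
    then have "((\<lambda>s. \<bar>s\<bar> powr p) has_real_derivative p * (- s) powr (p - 1) * (- 1)) (at s)"
      by (rule has_field_derivative_transform_within_open[where S = "{..<0}"]) (use 2 in auto)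
    then show ?thesis using 2 by simp
  next
    case 3
    have "((\<lambda>h::real. \<bar>h\<bar> powr (p - 1)) \<longlongrightarrow> 0 powr (p - 1)) (at 0)"
      using assms by (intro tendsto_powr' tendsto_rabs_zero tendsto_const tendsto_ident_at) auto
    then have "((\<lambda>h::real. \<bar>h\<bar> powr (p - 1)) \<longlongrightarrow> 0) (at 0)" by simp
    then have "((\<lambda>h. norm ((\<bar>0 + h\<bar> powr p - \<bar>0\<bar> powr p) / h)) \<longlongrightarrow> 0) (at 0)"
      by (rule Lim_transform_eventually) (auto simp: eventually_at_filter powr_diff)
    then have "((\<lambda>h. (\<bar>0 + h\<bar> powr p - \<bar>0\<bar> powr p) / h) \<longlongrightarrow> 0) (at 0)"
      by (rule tendsto_norm_zero_cancel)
    then show ?thesis using 3 by (simp add: DERIV_def)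
  qed
qed

text \<open>For a coordinate direction \<open>e\<close> the function \<open>(x \<bullet> e) |\<phi>|\<^sup>p\<close> is \<open>C\<^sup>1\<close> with compact support, so its
  derivative along \<open>e\<close> has integral \<open>0\<close>. Hence \<open>\<integral> |\<phi>|\<^sup>p\<close> equals, up to sign, the integral of
  \<open>(x \<bullet> e) p |\<phi>|\<^sup>p\<^sup>-\<^sup>1 sgn \<phi> (\<nabla>\<phi> \<bullet> e)\<close>, which is at most \<open>p R \<integral> |\<phi>|\<^sup>p\<^sup>-\<^sup>1 |\<nabla>\<phi>|\<close> if \<open>|x| \<le> R\<close> on \<open>\<Omega>\<close>. Young's
  inequality absorbs half of \<open>\<integral> |\<phi>|\<^sup>p\<close> into the left-hand side.\<close>

lemma Poincare_test:
  fixes \<Omega> :: "'a::euclidean_space set" and p :: real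
  assumes "open \<Omega>" and "bounded \<Omega>" and p: "p > 1"
  obtains C where "C > 0"
    and "\<And>\<phi>. \<phi> \<in> C1_c \<Omega> \<Longrightarrow>
      (\<integral>x. \<bar>\<phi> x\<bar> powr p \<partial>lebesgue_on \<Omega>) \<le> C * (\<integral>x. norm (grad \<phi> x) powr p \<partial>lebesgue_on \<Omega>)"
proof -
  obtain e :: 'a where e: "e \<in> Basis" using nonempty_Basis by blast
  obtain R where R: "R > 0" "\<And>x. x \<in> \<Omega> \<Longrightarrow> norm x \<le> R" using assms(2) by (metis bounded_pos)
  \<comment> \<open>With this choice the coefficient \<open>p R \<delta>\<close> of the absorbed term is \<open>1 / 2\<close>.\<close>
  define \<delta> where "\<delta> = 1 / (2 * p * R)"
  have \<delta>: "\<delta> > 0" using p R by (simp add: \<delta>_def)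
  define C where "C = 2 * (p * R * \<delta> powr (1 - p))"
  have "C > 0" using p R \<delta> by (simp add: C_def)
  moreover have "(\<integral>x. \<bar>\<phi> x\<bar> powr p \<partial>lebesgue_on \<Omega>) \<le> C * (\<integral>x. norm (grad \<phi> x) powr p \<partial>lebesgue_on \<Omega>)"
    if \<phi>: "\<phi> \<in> C1_c \<Omega>" for \<phi>
  proof -
    let ?M = "lebesgue_on \<Omega>"
    let ?q = "\<lambda>s. p * (max s 0 powr (p - 1) - max (- s) 0 powr (p - 1))"
    have q_cont: "continuous_on UNIV ?q"
      using p by (intro continuous_intros continuous_on_powr') auto
    have q_abs: "\<bar>?q s\<bar> = p * \<bar>s\<bar> powr (p - 1)" for s
      using p by (cases "s \<ge> 0") (auto simp: abs_mult max_def)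
    have C\<phi>: "C_on 1 UNIV \<phi>" using C1_cD[OF \<phi>] .
    obtain B where B: "B > 0" "\<And>x. \<bar>\<phi> x\<bar> \<le> B" "\<And>x. norm (grad \<phi> x) \<le> B"
      using C1_c_bounded[OF \<phi>] by metis
    have x_e: "C_on 1 UNIV (\<lambda>x. x \<bullet> e)" "grad (\<lambda>x. x \<bullet> e) = (\<lambda>x. e)"
      by (rule C1I[where G = "\<lambda>x. e"]; auto intro!: derivative_eq_intros simp: inner_commute)+
    note pow = C1_compose[OF C\<phi> abs_powr_has_derivative[OF p] q_cont]
    have pow_c: "(\<lambda>x. \<bar>\<phi> x\<bar> powr p) \<in> C1_c \<Omega>"
      using pow(1) \<phi> compact_support_in_mono[of \<Omega> \<phi> "\<lambda>x. \<bar>\<phi> x\<bar> powr p"]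
      unfolding C1_c_def mem_Collect_eq by simp
    have m[measurable]: "\<phi> \<in> borel_measurable ?M" "grad \<phi> \<in> borel_measurable ?M"
      using C1_c_measurable[OF \<phi>] by auto
    have int1: "integrable ?M (\<lambda>x. \<bar>\<phi> x\<bar> powr p)"
      by (rule integrable_bounded_open[OF assms(1,2), where B = "B powr p"])
         (use B p in \<open>auto intro!: powr_mono2\<close>)
    have int2: "integrable ?M (\<lambda>x. norm (grad \<phi> x) powr p)"
      by (rule integrable_bounded_open[OF assms(1,2), where B = "B powr p"])
         (use B p in \<open>auto intro!: powr_mono2\<close>)
    let ?T = "\<lambda>x. (x \<bullet> e) * (?q (\<phi> x) * (grad \<phi> x \<bullet> e))"
    have T_meas: "?T \<in> borel_measurable ?M"
      by (intro continuous_measurable_lebesgue_on continuous_intros C1_continuous_grad[OF C\<phi>]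
          continuous_on_compose2[OF q_cont C1_continuous[OF C\<phi>]]) auto
    let ?W = "\<lambda>x. p * R * (\<delta> * \<bar>\<phi> x\<bar> powr p + \<delta> powr (1 - p) * norm (grad \<phi> x) powr p)"
    have T_le: "\<bar>?T x\<bar> \<le> ?W x" if "x \<in> \<Omega>" for x
    proof -
      have "\<bar>?T x\<bar> = \<bar>x \<bullet> e\<bar> * ((p * \<bar>\<phi> x\<bar> powr (p - 1)) * \<bar>grad \<phi> x \<bullet> e\<bar>)"
        by (simp add: abs_mult flip: q_abs)
      also have "\<dots> \<le> R * ((p * \<bar>\<phi> x\<bar> powr (p - 1)) * norm (grad \<phi> x))"
        using R p that order_trans[OF Basis_le_norm[OF e, of x] R(2)] Basis_le_norm[OF e, of "grad \<phi> x"]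
        by (intro mult_mono) auto
      also have "\<dots> = p * R * (\<bar>\<phi> x\<bar> powr (p - 1) * norm (grad \<phi> x))" by simp
      also have "\<dots> \<le> ?W x"
        using p R \<delta> powr_Young[of "\<bar>\<phi> x\<bar>" "norm (grad \<phi> x)" \<delta> p] by (intro mult_left_mono) auto
      finally show ?thesis .
    qed
    have int_W: "integrable ?M ?W" using int1 int2 by simp
    have int_T: "integrable ?M ?T"
      by (rule Bochner_Integration.integrable_bound[OF int_W T_meas], rule AE_I2)
         (use T_le in \<open>force intro: order_trans\<close>)
    have "(\<integral>x. ?T x + \<bar>\<phi> x\<bar> powr p \<partial>?M) = (\<integral>x. grad (\<lambda>x. (x \<bullet> e) * \<bar>\<phi> x\<bar> powr p) x \<bullet> e \<partial>?M)"
      using e by (simp add: C1_mult(2)[OF x_e(1) pow(1)] pow(2) x_e(2) inner_add_left inner_Basis mult.assoc)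
    also have "\<dots> = 0"
      by (rule integral_grad_inner_zero[OF assms(1) C1_mult_C1_c[OF x_e(1) pow_c]])
    finally have "(\<integral>x. \<bar>\<phi> x\<bar> powr p \<partial>?M) = - (\<integral>x. ?T x \<partial>?M)"
      using int_T int1 by (simp add: Bochner_Integration.integral_add[OF int_T int1])
    also have "\<dots> \<le> (\<integral>x. \<bar>?T x\<bar> \<partial>?M)"
      using integral_abs_bound[of ?M ?T] by linarith
    also have "\<dots> \<le> (\<integral>x. ?W x \<partial>?M)"
      using T_le by (intro integral_mono integrable_abs int_T int_W) simp
    also have "\<dots> = p * R * \<delta> * (\<integral>x. \<bar>\<phi> x\<bar> powr p \<partial>?M)
        + p * R * \<delta> powr (1 - p) * (\<integral>x. norm (grad \<phi> x) powr p \<partial>?M)"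
      using int1 int2 by (simp add: algebra_simps)
    also have "p * R * \<delta> = 1 / 2" using p R by (simp add: \<delta>_def)
    finally show ?thesis by (simp add: C_def)
  qed
  ultimately show ?thesis using that by blast
qed

section \<open>Approximation by test functions\<close>

lemma integral_Holder_tendsto_zero:
  fixes a :: "'a \<Rightarrow> real" and b :: "nat \<Rightarrow> 'a \<Rightarrow> real"
  assumes p: "p \<ge> 1" and [measurable]: "a \<in> borel_measurable M" "\<And>n. b n \<in> borel_measurable M"
    and a0: "\<And>x. a x \<ge> 0" and b0: "\<And>n x. b n x \<ge> 0"
    and a: "integrable M (\<lambda>x. a x powr p)" and b: "\<And>n. integrable M (\<lambda>x. b n x powr p)"
    and lim: "(\<lambda>n. \<integral>x. b n x powr p \<partial>M) \<longlonglongrightarrow> 0"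
  shows "integrable M (\<lambda>x. a x powr (p - 1) * b n x)"
    and "(\<lambda>n. \<integral>x. a x powr (p - 1) * b n x \<partial>M) \<longlonglongrightarrow> 0"
proof -
  have int: "integrable M (\<lambda>x. a x powr (p - 1) * b n x)" for n
  proof (rule Bochner_Integration.integrable_bound)
    show "integrable M (\<lambda>x. 1 * a x powr p + 1 powr (1 - p) * b n x powr p)" using a b by simp
    show "AE x in M. norm (a x powr (p - 1) * b n x) \<le> norm (1 * a x powr p + 1 powr (1 - p) * b n x powr p)"
    proof (rule AE_I2)
      fix x
      show "norm (a x powr (p - 1) * b n x) \<le> norm (1 * a x powr p + 1 powr (1 - p) * b n x powr p)"
        using powr_Young[OF a0 b0 zero_less_one p, of x n x] b0[of n x] by (simp add: abs_mult)
    qed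
  qed simp
  then show "integrable M (\<lambda>x. a x powr (p - 1) * b n x)" .
  let ?A = "\<integral>x. a x powr p \<partial>M" and ?B = "\<lambda>n. \<integral>x. b n x powr p \<partial>M"
  have A0: "?A \<ge> 0" by simp
  show "(\<lambda>n. \<integral>x. a x powr (p - 1) * b n x \<partial>M) \<longlonglongrightarrow> 0"
  proof (rule tendstoI)
    fix \<epsilon> :: real assume \<epsilon>: "\<epsilon> > 0"
    define \<delta> where "\<delta> = \<epsilon> / (2 * (?A + 1))"
    have \<delta>: "\<delta> > 0" unfolding \<delta>_def using \<epsilon> A0
      by (intro divide_pos_pos mult_pos_pos add_nonneg_pos) auto
    have "\<epsilon> / (2 * (A + 1)) * A \<le> \<epsilon> / 2" if "A \<ge> 0" for A
      using that \<epsilon> by (simp add: field_simps)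
    from this[OF A0] have \<delta>A: "\<delta> * ?A \<le> \<epsilon> / 2" by (simp only: \<delta>_def)
    have "(\<lambda>n. \<delta> powr (1 - p) * ?B n) \<longlonglongrightarrow> \<delta> powr (1 - p) * 0"
      by (intro tendsto_intros lim)
    then have "\<forall>\<^sub>F n in sequentially. \<delta> powr (1 - p) * ?B n < \<epsilon> / 2"
      by (rule order_tendstoD(2)) (use \<epsilon> in simp)
    then show "\<forall>\<^sub>F n in sequentially. dist (\<integral>x. a x powr (p - 1) * b n x \<partial>M) 0 < \<epsilon>"
    proof eventually_elim
      case (elim n)
      have "(\<integral>x. a x powr (p - 1) * b n x \<partial>M) \<le> (\<integral>x. \<delta> * a x powr p + \<delta> powr (1 - p) * b n x powr p \<partial>M)"
        using a b by (intro integral_mono int powr_Young a0 b0 \<delta> p) auto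
      also have "\<dots> = \<delta> * ?A + \<delta> powr (1 - p) * ?B n" using a b by simp
      also have "\<dots> < \<epsilon>" using elim \<delta>A by linarith
      finally have "(\<integral>x. a x powr (p - 1) * b n x \<partial>M) < \<epsilon>" .
      moreover have "(\<integral>x. a x powr (p - 1) * b n x \<partial>M) \<ge> 0" using b0 by simp
      ultimately show ?case by simp
    qed
  qed
qed

text \<open>The case \<open>a = 1\<close> of the preceding lemma: on a finite measure space, convergence in \<open>L\<^sup>p\<close> implies
  convergence in \<open>L\<^sup>1\<close>.\<close>

lemma (in finite_measure) integral_tendsto_zero_if_powr:
  fixes b :: "nat \<Rightarrow> 'a \<Rightarrow> real"
  assumes "p \<ge> 1" and "\<And>n. b n \<in> borel_measurable M" and "\<And>n x. b n x \<ge> 0"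
    and "\<And>n. integrable M (\<lambda>x. b n x powr p)" and "(\<lambda>n. \<integral>x. b n x powr p \<partial>M) \<longlonglongrightarrow> 0"
  shows "integrable M (b n)" and "(\<lambda>n. \<integral>x. b n x \<partial>M) \<longlonglongrightarrow> 0"
  using integral_Holder_tendsto_zero[of p "\<lambda>x. 1" M b] assms by auto

lemma L_on_diff_bounded:
  fixes u h :: "'a::euclidean_space \<Rightarrow> 'b::euclidean_space"
  assumes "open \<Omega>" and "bounded \<Omega>" and p: "p \<ge> 1" and u: "L_on p \<Omega> u"
    and h: "h \<in> borel_measurable (lebesgue_on \<Omega>)" and B: "\<And>x. norm (h x) \<le> B"
  shows "integrable (lebesgue_on \<Omega>) (\<lambda>x. norm (u x - h x) powr p)"
proof (rule Bochner_Integration.integrable_bound)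
  have "integrable (lebesgue_on \<Omega>) (\<lambda>x. norm (h x) powr p)"
    by (rule integrable_bounded_open[OF assms(1,2), where B = "B powr p"])
       (use h B p in \<open>auto intro!: powr_mono2\<close>)
  then show "integrable (lebesgue_on \<Omega>) (\<lambda>x. 2 powr p * (norm (u x) powr p + norm (h x) powr p))"
    using u by (simp add: L_on_def)
  show "(\<lambda>x. norm (u x - h x) powr p) \<in> borel_measurable (lebesgue_on \<Omega>)"
    using u h by (auto simp: L_on_def)
  have "norm (u x - h x) powr p \<le> 2 powr p * (norm (u x) powr p + norm (h x) powr p)" for x
    using powr_add_le[of "norm (u x)" "norm (h x)" p] p norm_triangle_ineq4[of "u x" "h x"]
    by (smt (verit) norm_ge_zero powr_mono2)
  then show "AE x in lebesgue_on \<Omega>. norm (norm (u x - h x) powr p)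
      \<le> norm (2 powr p * (norm (u x) powr p + norm (h x) powr p))"
    by (auto intro!: AE_I2 order_trans[OF _ abs_ge_self])
qed

lemma tendsto_if_dist_powr_tendsto_zero:
  fixes f :: "nat \<Rightarrow> 'b::real_normed_vector"
  assumes p: "p > 0" and le: "\<And>n. norm (l - f n) powr p \<le> w n" and w: "w \<longlonglongrightarrow> 0"
  shows "f \<longlonglongrightarrow> l"
proof -
  have "(\<lambda>n. norm (l - f n) powr p) \<longlonglongrightarrow> 0"
    by (rule tendsto_sandwich[OF _ _ tendsto_const w]) (use le in auto)
  then have "(\<lambda>n. (norm (l - f n) powr p) powr (1 / p)) \<longlonglongrightarrow> 0 powr (1 / p)"
    using p by (intro tendsto_powr') auto
  then have "(\<lambda>n. norm (l - f n)) \<longlonglongrightarrow> 0" using p by (simp add: powr_powr)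
  then have "(\<lambda>n. l - f n) \<longlonglongrightarrow> 0" by (rule tendsto_norm_zero_cancel)
  then have "(\<lambda>n. l - (l - f n)) \<longlonglongrightarrow> l - 0" by (intro tendsto_intros)
  then show ?thesis by simp
qed

text \<open>The defining property of \<open>W\<^sub>0\<^sup>1\<^sup>,\<^sup>p\<close> in sequential form, along a subsequence for which the functions
  and their gradients also converge almost everywhere.\<close>

definition test_approximation ::
    "real \<Rightarrow> 'a::euclidean_space set \<Rightarrow> ('a \<Rightarrow> real) \<Rightarrow> ('a \<Rightarrow> 'a) \<Rightarrow> (nat \<Rightarrow> 'a \<Rightarrow> real) \<Rightarrow> bool" where
  "test_approximation p \<Omega> u g \<phi> \<longleftrightarrow>
     L_on p \<Omega> u \<and> L_on p \<Omega> g \<and> (\<forall>n. \<phi> n \<in> Cinf_c \<Omega>) \<and>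
     (\<lambda>n. \<integral>x. norm (u x - \<phi> n x) powr p \<partial>lebesgue_on \<Omega>) \<longlonglongrightarrow> 0 \<and>
     (\<lambda>n. \<integral>x. norm (g x - grad (\<phi> n) x) powr p \<partial>lebesgue_on \<Omega>) \<longlonglongrightarrow> 0 \<and>
     (AE x in lebesgue_on \<Omega>. (\<lambda>n. \<phi> n x) \<longlonglongrightarrow> u x) \<and>
     (AE x in lebesgue_on \<Omega>. (\<lambda>n. grad (\<phi> n) x) \<longlonglongrightarrow> g x)"

lemma L_on_diff_test:
  assumes "open \<Omega>" "bounded \<Omega>" "p \<ge> 1" "\<phi> \<in> C1_c \<Omega>"
  shows "L_on p \<Omega> u \<Longrightarrow> integrable (lebesgue_on \<Omega>) (\<lambda>x. norm (u x - \<phi> x) powr p)"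
    and "L_on p \<Omega> g \<Longrightarrow> integrable (lebesgue_on \<Omega>) (\<lambda>x. norm (g x - grad \<phi> x) powr p)"
proof -
  obtain B where B: "\<And>x. \<bar>\<phi> x\<bar> \<le> B" "\<And>x. norm (grad \<phi> x) \<le> B"
    using C1_c_bounded[OF assms(4)] by metis
  show "L_on p \<Omega> u \<Longrightarrow> integrable (lebesgue_on \<Omega>) (\<lambda>x. norm (u x - \<phi> x) powr p)"
    by (rule L_on_diff_bounded[OF assms(1-3) _ C1_c_measurable(1)[OF assms(4)], where B = B]) (simp_all add: B)
  show "L_on p \<Omega> g \<Longrightarrow> integrable (lebesgue_on \<Omega>) (\<lambda>x. norm (g x - grad \<phi> x) powr p)"
    by (rule L_on_diff_bounded[OF assms(1-3) _ C1_c_measurable(2)[OF assms(4)], where B = B]) (simp_all add: B)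
qed

text \<open>The pointwise sum of the \<open>p\<close>-th powers of both errors tends to \<open>0\<close> in \<open>L\<^sup>1\<close>; one subsequence of
  it that converges almost everywhere serves the functions and the gradients simultaneously.\<close>

lemma W0_test_approximation:
  fixes \<Omega> :: "'a::euclidean_space set"
  assumes \<Omega>: "open \<Omega>" "bounded \<Omega>" and p: "p \<ge> 1" and u: "W0 p \<Omega> u"
  obtains g \<phi> where "has_weak_gradient \<Omega> u g" and "test_approximation p \<Omega> u g \<phi>"
proof -
  let ?M = "lebesgue_on \<Omega>"
  obtain g where g: "has_weak_gradient \<Omega> u g" and Lu: "L_on p \<Omega> u" and Lg: "L_on p \<Omega> g"
    and approx: "\<And>\<epsilon>. \<epsilon> > 0 \<Longrightarrow>
      \<exists>\<phi>\<in>Cinf_c \<Omega>. sobolev_norm p \<Omega> (\<lambda>x. u x - \<phi> x) (\<lambda>x. g x - grad \<phi> x) < \<epsilon>"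
    using u unfolding W0_def by blast
  obtain \<phi> where \<phi>: "\<And>n. \<phi> n \<in> Cinf_c \<Omega>"
    and norm_le: "\<And>n. sobolev_norm p \<Omega> (\<lambda>x. u x - \<phi> n x) (\<lambda>x. g x - grad (\<phi> n) x) < inverse (real (Suc n))"
    using approx[of "inverse (real (Suc _))"] by (metis inverse_positive_iff_positive of_nat_0_less_iff zero_less_Suc)
  note \<phi>1 = Cinf_c_imp_C1_c[OF \<phi>]
  let ?a = "\<lambda>n x. norm (u x - \<phi> n x) powr p" and ?b = "\<lambda>n x. norm (g x - grad (\<phi> n) x) powr p"
  have ia: "integrable ?M (?a n)" and ib: "integrable ?M (?b n)" for n
    using L_on_diff_test[OF \<Omega> p \<phi>1] Lu Lg by auto
  let ?A = "\<lambda>n. integral\<^sup>L ?M (?a n)" and ?B = "\<lambda>n. integral\<^sup>L ?M (?b n)"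
  have nonneg: "?A n \<ge> 0" "?B n \<ge> 0" for n by simp_all
  have bound: "?A n + ?B n \<le> inverse (real (Suc n))" for n
  proof -
    have "((?A n + ?B n) powr (1 / p)) powr p \<le> inverse (real (Suc n)) powr p"
      using norm_le[of n] p by (intro powr_mono2) (auto simp: sobolev_norm_def)
    also have "\<dots> \<le> inverse (real (Suc n)) powr 1"
      using p by (intro powr_mono') (auto simp: inverse_le_1_iff)
    finally show ?thesis using p nonneg[of n] by (simp add: powr_powr del: of_nat_Suc)
  qed
  have A: "?A \<longlonglongrightarrow> 0" and B: "?B \<longlonglongrightarrow> 0" and AB: "(\<lambda>n. ?A n + ?B n) \<longlonglongrightarrow> 0"
    by (rule tendsto_sandwich[OF _ _ tendsto_const LIMSEQ_inverse_real_of_nat];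
        use bound nonneg in \<open>auto intro!: always_eventually intro: order_trans[OF _ bound] add_nonneg_nonneg simp del: of_nat_Suc\<close>)+
  obtain r where r: "strict_mono r" "AE x in ?M. (\<lambda>n. ?a (r n) x + ?b (r n) x) \<longlonglongrightarrow> 0"
    using tendsto_L1_AE_subseq[of ?M "\<lambda>n x. ?a n x + ?b n x"] AB ia ib by auto
  have "AE x in ?M. (\<lambda>n. \<phi> (r n) x) \<longlonglongrightarrow> u x"
    using r(2) by eventually_elim (rule tendsto_if_dist_powr_tendsto_zero[of p], use p in auto)
  moreover have "AE x in ?M. (\<lambda>n. grad (\<phi> (r n)) x) \<longlonglongrightarrow> g x"
    using r(2) by eventually_elim (rule tendsto_if_dist_powr_tendsto_zero[of p], use p in auto)
  moreover have "(\<lambda>n. ?A (r n)) \<longlonglongrightarrow> 0" "(\<lambda>n. ?B (r n)) \<longlonglongrightarrow> 0"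
    using LIMSEQ_subseq_LIMSEQ[OF A r(1)] LIMSEQ_subseq_LIMSEQ[OF B r(1)] by (auto simp: o_def)
  ultimately have "test_approximation p \<Omega> u g (\<lambda>n. \<phi> (r n))"
    using Lu Lg \<phi> by (simp add: test_approximation_def)
  with g show ?thesis by (rule that)
qed

lemma integrable_if_powr_integrable:
  fixes w :: "'a \<Rightarrow> real"
  assumes "finite_measure M" and "p \<ge> 1" and "w \<in> borel_measurable M"
    and "integrable M (\<lambda>x. \<bar>w x\<bar> powr p)"
  shows "integrable M w"
proof (rule Bochner_Integration.integrable_bound)
  interpret finite_measure M by fact
  show "integrable M (\<lambda>x. 1 + \<bar>w x\<bar> powr p)" using assms(4) by simp
  have "\<bar>s\<bar> \<le> 1 + \<bar>s\<bar> powr p" for s :: real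
    using powr_Young[of 1 "\<bar>s\<bar>" 1 p] assms(2) by simp
  then show "AE x in M. norm (w x) \<le> norm (1 + \<bar>w x\<bar> powr p)" by (auto intro!: AE_I2)
qed fact

lemma test_approximation_L1:
  fixes \<Omega> :: "'a::euclidean_space set"
  assumes \<Omega>: "open \<Omega>" "bounded \<Omega>" and p: "p \<ge> 1" and ap: "test_approximation p \<Omega> u g \<phi>"
  shows "integrable (lebesgue_on \<Omega>) u" and "integrable (lebesgue_on \<Omega>) g"
    and "(\<lambda>n. \<integral>x. \<bar>u x - \<phi> n x\<bar> \<partial>lebesgue_on \<Omega>) \<longlonglongrightarrow> 0"
    and "(\<lambda>n. \<integral>x. norm (g x - grad (\<phi> n) x) \<partial>lebesgue_on \<Omega>) \<longlonglongrightarrow> 0"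
    and "integrable (lebesgue_on \<Omega>) (\<lambda>x. norm (g x - grad (\<phi> n) x))"
proof -
  interpret finite_measure "lebesgue_on \<Omega>" by (rule finite_measure_bounded_open[OF \<Omega>])
  have Lu: "L_on p \<Omega> u" and Lg: "L_on p \<Omega> g" and \<phi>: "\<And>n. \<phi> n \<in> C1_c \<Omega>"
    using ap Cinf_c_imp_C1_c by (auto simp: test_approximation_def)
  have m[measurable]: "u \<in> borel_measurable (lebesgue_on \<Omega>)" "g \<in> borel_measurable (lebesgue_on \<Omega>)"
    "\<And>n. \<phi> n \<in> borel_measurable (lebesgue_on \<Omega>)" "\<And>n. grad (\<phi> n) \<in> borel_measurable (lebesgue_on \<Omega>)"
    using Lu Lg C1_c_measurable[OF \<phi>] by (auto simp: L_on_def)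
  show "integrable (lebesgue_on \<Omega>) u"
    by (rule integrable_if_powr_integrable[OF finite_measure_axioms p]) (use Lu in \<open>auto simp: L_on_def\<close>)
  have "integrable (lebesgue_on \<Omega>) (\<lambda>x. norm (g x))"
    by (rule integrable_if_powr_integrable[OF finite_measure_axioms p]) (use Lg in \<open>auto simp: L_on_def\<close>)
  then show "integrable (lebesgue_on \<Omega>) g" by (subst (asm) integrable_norm_iff) auto
  show "(\<lambda>n. \<integral>x. \<bar>u x - \<phi> n x\<bar> \<partial>lebesgue_on \<Omega>) \<longlonglongrightarrow> 0"
    by (rule integral_tendsto_zero_if_powr[OF p])
       (use L_on_diff_test(1)[OF \<Omega> p \<phi> Lu] ap in \<open>auto simp: test_approximation_def\<close>)
  show "(\<lambda>n. \<integral>x. norm (g x - grad (\<phi> n) x) \<partial>lebesgue_on \<Omega>) \<longlonglongrightarrow> 0"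
    and "integrable (lebesgue_on \<Omega>) (\<lambda>x. norm (g x - grad (\<phi> n) x))"
    by (rule integral_tendsto_zero_if_powr[OF p];
        use L_on_diff_test(2)[OF \<Omega> p \<phi> Lg] ap in \<open>auto simp: test_approximation_def\<close>)+
qed

section \<open>The generalized gradient is the weak gradient\<close>

text \<open>For the approximating test functions this is integration by parts. In the limit, \<open>\<psi>' (\<phi>\<^sub>n) \<nabla>\<phi>\<^sub>n\<close> is
  split into \<open>\<psi>' (\<phi>\<^sub>n) g\<close>, which is dominated by a multiple of \<open>|g|\<close>, and \<open>\<psi>' (\<phi>\<^sub>n) (g - \<nabla>\<phi>\<^sub>n)\<close>, which
  tends to \<open>0\<close> in \<open>L\<^sup>1\<close>.\<close>

lemma weak_chain_rule:
  fixes \<Omega> :: "'a::euclidean_space set"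
  assumes \<Omega>: "open \<Omega>" "bounded \<Omega>" and p: "p \<ge> 1" and ap: "test_approximation p \<Omega> u g \<phi>"
    and psi: "\<And>s. (\<psi> has_real_derivative \<psi>' s) (at s)" and cont: "continuous_on UNIV \<psi>'"
    and bd: "\<And>s. \<bar>\<psi> s\<bar> \<le> B" "\<And>s. \<bar>\<psi>' s\<bar> \<le> B"
    and \<eta>: "\<eta> \<in> C1_c \<Omega>"
  shows "(\<integral>x. \<psi> (u x) *\<^sub>R grad \<eta> x \<partial>lebesgue_on \<Omega>) = - (\<integral>x. \<eta> x *\<^sub>R \<psi>' (u x) *\<^sub>R g x \<partial>lebesgue_on \<Omega>)"
proof -
  let ?M = "lebesgue_on \<Omega>"
  interpret finite_measure ?M by (rule finite_measure_bounded_open[OF \<Omega>])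
  note L1 = test_approximation_L1[OF \<Omega> p ap]
  have \<phi>: "\<And>n. \<phi> n \<in> C1_c \<Omega>" using ap Cinf_c_imp_C1_c by (auto simp: test_approximation_def)
  have \<phi>u: "AE x in ?M. (\<lambda>n. \<phi> n x) \<longlonglongrightarrow> u x" using ap by (simp add: test_approximation_def)
  have psi_cont: "continuous_on UNIV \<psi>"
    by (intro continuous_at_imp_continuous_on ballI DERIV_isCont[OF psi])
  have [measurable]: "\<psi> \<in> borel_measurable borel" "\<psi>' \<in> borel_measurable borel"
    using psi_cont cont by (auto intro: borel_measurable_continuous_onI)
  have [measurable]: "u \<in> borel_measurable ?M" "g \<in> borel_measurable ?M"
    "\<And>n. \<phi> n \<in> borel_measurable ?M" "\<And>n. grad (\<phi> n) \<in> borel_measurable ?M"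
    "\<eta> \<in> borel_measurable ?M" "grad \<eta> \<in> borel_measurable ?M"
    using L1(1,2) C1_c_measurable[OF \<phi>] C1_c_measurable[OF \<eta>] by auto
  obtain D where D: "D > 0" "\<And>x. \<bar>\<eta> x\<bar> \<le> D" "\<And>x. norm (grad \<eta> x) \<le> D"
    using C1_c_bounded[OF \<eta>] by metis
  have B0: "B \<ge> 0" using bd(1)[of 0] by linarith
  have le: "norm (\<eta> x *\<^sub>R \<psi>' t *\<^sub>R w) \<le> D * (B * norm w)" for x t and w :: 'a
  proof -
    have "\<bar>\<eta> x\<bar> * (\<bar>\<psi>' t\<bar> * norm w) \<le> D * (B * norm w)"
      using D B0 by (intro mult_mono mult_right_mono bd) auto
    then show ?thesis by (simp add: abs_mult mult.assoc)
  qed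
  have isC: "isCont \<psi> s" "isCont \<psi>' s" for s
    using psi_cont cont by (auto simp: continuous_on_eq_continuous_at)
  have lim1: "(\<lambda>n. \<integral>x. \<psi> (\<phi> n x) *\<^sub>R grad \<eta> x \<partial>?M) \<longlonglongrightarrow> (\<integral>x. \<psi> (u x) *\<^sub>R grad \<eta> x \<partial>?M)"
  proof (rule integral_dominated_convergence)
    show "integrable ?M (\<lambda>x. B * D)" by simp
    show "AE x in ?M. (\<lambda>n. \<psi> (\<phi> n x) *\<^sub>R grad \<eta> x) \<longlonglongrightarrow> \<psi> (u x) *\<^sub>R grad \<eta> x"
      using \<phi>u by eventually_elim (intro tendsto_scaleR isCont_tendsto_compose[OF isC(1)] tendsto_const)
    show "AE x in ?M. norm (\<psi> (\<phi> n x) *\<^sub>R grad \<eta> x) \<le> B * D" for n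
      using bd D B0 by (intro AE_I2) (auto intro!: mult_mono)
  qed measurable
  have lim2: "(\<lambda>n. \<integral>x. \<eta> x *\<^sub>R \<psi>' (\<phi> n x) *\<^sub>R g x \<partial>?M) \<longlonglongrightarrow> (\<integral>x. \<eta> x *\<^sub>R \<psi>' (u x) *\<^sub>R g x \<partial>?M)"
    and int2: "integrable ?M (\<lambda>x. \<eta> x *\<^sub>R \<psi>' (\<phi> n x) *\<^sub>R g x)" for n
  proof -
    have 1: "integrable ?M (\<lambda>x. D * (B * norm (g x)))" using L1(2) by simp
    have 2: "AE x in ?M. (\<lambda>n. \<eta> x *\<^sub>R \<psi>' (\<phi> n x) *\<^sub>R g x) \<longlonglongrightarrow> \<eta> x *\<^sub>R \<psi>' (u x) *\<^sub>R g x"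
      using \<phi>u by eventually_elim (intro tendsto_scaleR isCont_tendsto_compose[OF isC(2)] tendsto_const)
    have 3: "AE x in ?M. norm (\<eta> x *\<^sub>R \<psi>' (\<phi> n x) *\<^sub>R g x) \<le> D * (B * norm (g x))" for n
      by (intro AE_I2 le)
    show "(\<lambda>n. \<integral>x. \<eta> x *\<^sub>R \<psi>' (\<phi> n x) *\<^sub>R g x \<partial>?M) \<longlonglongrightarrow> (\<integral>x. \<eta> x *\<^sub>R \<psi>' (u x) *\<^sub>R g x \<partial>?M)"
      by (rule integral_dominated_convergence[OF _ _ 1 2 3]) measurable
    show "integrable ?M (\<lambda>x. \<eta> x *\<^sub>R \<psi>' (\<phi> n x) *\<^sub>R g x)"
      by (rule integrable_dominated_convergence2[OF _ _ 1 2 3]) measurable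
  qed
  have int3: "integrable ?M (\<lambda>x. \<eta> x *\<^sub>R \<psi>' (\<phi> n x) *\<^sub>R (g x - grad (\<phi> n) x))"
    and le3: "norm (\<integral>x. \<eta> x *\<^sub>R \<psi>' (\<phi> n x) *\<^sub>R (g x - grad (\<phi> n) x) \<partial>?M)
      \<le> D * B * (\<integral>x. norm (g x - grad (\<phi> n) x) \<partial>?M)" for n
  proof -
    have le: "norm (\<eta> x *\<^sub>R \<psi>' (\<phi> n x) *\<^sub>R (g x - grad (\<phi> n) x)) \<le> D * B * norm (g x - grad (\<phi> n) x)" for x
      unfolding mult.assoc by (rule le)
    have i: "integrable ?M (\<lambda>x. D * B * norm (g x - grad (\<phi> n) x))" using L1(5) by simp
    show int: "integrable ?M (\<lambda>x. \<eta> x *\<^sub>R \<psi>' (\<phi> n x) *\<^sub>R (g x - grad (\<phi> n) x))"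
    proof (rule Bochner_Integration.integrable_bound[OF i])
      show "AE x in ?M. norm (\<eta> x *\<^sub>R \<psi>' (\<phi> n x) *\<^sub>R (g x - grad (\<phi> n) x))
          \<le> norm (D * B * norm (g x - grad (\<phi> n) x))"
        by (rule AE_I2, rule order_trans[OF le]) simp
    qed measurable
    have "norm (\<integral>x. \<eta> x *\<^sub>R \<psi>' (\<phi> n x) *\<^sub>R (g x - grad (\<phi> n) x) \<partial>?M)
        \<le> (\<integral>x. norm (\<eta> x *\<^sub>R \<psi>' (\<phi> n x) *\<^sub>R (g x - grad (\<phi> n) x)) \<partial>?M)"
      by (rule integral_norm_bound)
    also have "\<dots> \<le> (\<integral>x. D * B * norm (g x - grad (\<phi> n) x) \<partial>?M)"
      by (rule integral_mono[OF integrable_norm[OF int] i le])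
    finally show "norm (\<integral>x. \<eta> x *\<^sub>R \<psi>' (\<phi> n x) *\<^sub>R (g x - grad (\<phi> n) x) \<partial>?M)
      \<le> D * B * (\<integral>x. norm (g x - grad (\<phi> n) x) \<partial>?M)" by simp
  qed
  have lim3: "(\<lambda>n. \<integral>x. \<eta> x *\<^sub>R \<psi>' (\<phi> n x) *\<^sub>R (g x - grad (\<phi> n) x) \<partial>?M) \<longlonglongrightarrow> 0"
  proof (rule Lim_null_comparison)
    show "\<forall>\<^sub>F n in sequentially. norm (\<integral>x. \<eta> x *\<^sub>R \<psi>' (\<phi> n x) *\<^sub>R (g x - grad (\<phi> n) x) \<partial>?M)
      \<le> D * B * (\<integral>x. norm (g x - grad (\<phi> n) x) \<partial>?M)"
      using le3 by (intro always_eventually allI)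
    show "(\<lambda>n. D * B * (\<integral>x. norm (g x - grad (\<phi> n) x) \<partial>?M)) \<longlonglongrightarrow> 0"
      using tendsto_mult_left[OF L1(4), of "D * B"] by simp
  qed
  have "(\<integral>x. \<psi> (\<phi> n x) *\<^sub>R grad \<eta> x \<partial>?M)
      = - ((\<integral>x. \<eta> x *\<^sub>R \<psi>' (\<phi> n x) *\<^sub>R g x \<partial>?M)
        - (\<integral>x. \<eta> x *\<^sub>R \<psi>' (\<phi> n x) *\<^sub>R (g x - grad (\<phi> n) x) \<partial>?M))" for n
  proof -
    note comp = C1_compose[OF C1_cD[OF \<phi>[of n]] psi cont]
    have "(\<integral>x. \<eta> x *\<^sub>R \<psi>' (\<phi> n x) *\<^sub>R g x \<partial>?M)
        - (\<integral>x. \<eta> x *\<^sub>R \<psi>' (\<phi> n x) *\<^sub>R (g x - grad (\<phi> n) x) \<partial>?M)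
        = (\<integral>x. \<eta> x *\<^sub>R \<psi>' (\<phi> n x) *\<^sub>R grad (\<phi> n) x \<partial>?M)"
      unfolding Bochner_Integration.integral_diff[OF int2 int3, symmetric]
      by (simp add: scaleR_diff_right)
    then show ?thesis
      using integration_by_parts_test[OF \<Omega> comp(1) \<eta>] by (simp add: comp(2))
  qed
  then have "(\<lambda>n. - ((\<integral>x. \<eta> x *\<^sub>R \<psi>' (\<phi> n x) *\<^sub>R g x \<partial>?M)
        - (\<integral>x. \<eta> x *\<^sub>R \<psi>' (\<phi> n x) *\<^sub>R (g x - grad (\<phi> n) x) \<partial>?M)))
      \<longlonglongrightarrow> (\<integral>x. \<psi> (u x) *\<^sub>R grad \<eta> x \<partial>?M)"
    using lim1 by simp
  moreover have "(\<lambda>n. - ((\<integral>x. \<eta> x *\<^sub>R \<psi>' (\<phi> n x) *\<^sub>R g x \<partial>?M)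
        - (\<integral>x. \<eta> x *\<^sub>R \<psi>' (\<phi> n x) *\<^sub>R (g x - grad (\<phi> n) x) \<partial>?M)))
      \<longlonglongrightarrow> - ((\<integral>x. \<eta> x *\<^sub>R \<psi>' (u x) *\<^sub>R g x \<partial>?M) - 0)"
    by (intro tendsto_intros lim2 lim3)
  ultimately show ?thesis using LIMSEQ_unique by fastforce
qed

lemma max_0_squared_has_derivative:
  "((\<lambda>s. (max 0 s)\<^sup>2) has_real_derivative 2 * max 0 s) (at s)"
proof -
  consider "s > 0" | "s < 0" | "s = 0" by linarith
  then show ?thesis
  proof cases
    case 1
    have "((\<lambda>s. s\<^sup>2) has_real_derivative 2 * s) (at s)" by (auto intro!: derivative_eq_intros)
    then have "((\<lambda>s. (max 0 s)\<^sup>2) has_real_derivative 2 * s) (at s)"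
      by (rule has_field_derivative_transform_within_open[where S = "{0<..}"]) (use 1 in auto)
    then show ?thesis using 1 by simp
  next
    case 2
    have "((\<lambda>s. 0) has_real_derivative 0) (at s)" by simp
    then have "((\<lambda>s. (max 0 s)\<^sup>2) has_real_derivative 0) (at s)"
      by (rule has_field_derivative_transform_within_open[where S = "{..<0}"]) (use 2 in auto)
    then show ?thesis using 2 by simp
  next
    case 3
    have "((\<lambda>h. max 0 h) \<longlongrightarrow> max 0 0) (at (0::real))" by (intro tendsto_intros)
    then have "((\<lambda>h. ((max 0 (0 + h))\<^sup>2 - (max 0 0)\<^sup>2) / h) \<longlongrightarrow> 0) (at (0::real))"
      by (simp, elim Lim_transform_eventually)
         (auto simp: eventually_at_filter max_def power2_eq_square)
    then show ?thesis using 3 by (simp add: DERIV_def)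
  qed
qed

text \<open>For \<open>p < 2\<close> local integrability of \<open>|v|\<^sup>p\<^sup>-\<^sup>1\<close> does not give local integrability of \<open>v\<close>, so the
  truncation level cannot simply be sent to infinity. Instead the chain rule is applied both to \<open>u\<close>
  and to \<open>T\<^sub>k(u)\<close>, with a function \<open>\<psi>\<close> for which \<open>\<psi> (T\<^sub>k(u)) = \<psi> (u)\<close>. Both \<open>\<psi>' (u) g\<close> and
  \<open>\<psi>' (u) \<nabla>T\<^sub>k(u)\<close> are then weak gradients of \<open>\<psi> (u)\<close>, and they agree almost everywhere. Where
  \<open>0 < u < k\<close>, the factor \<open>\<psi>' (u)\<close> is nonzero and \<open>\<nabla>T\<^sub>k(u) = v\<close>.\<close>

lemma generalized_gradient_eq_weak_gradient:
  fixes \<Omega> :: "'a::euclidean_space set"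
  assumes \<Omega>: "open \<Omega>" "bounded \<Omega>" and p: "p \<ge> 1" and ap: "test_approximation p \<Omega> u g \<phi>"
    and g: "has_weak_gradient \<Omega> u g" and v: "has_generalized_gradient \<Omega> u v"
    and tr: "\<And>k. k > 0 \<Longrightarrow> W0 1 \<Omega> (\<lambda>x. trunc k (u x))"
    and pos: "AE x in lebesgue_on \<Omega>. u x > 0"
  shows "AE x in lebesgue_on \<Omega>. v x = g x"
proof -
  let ?M = "lebesgue_on \<Omega>"
  have "AE x in ?M. 0 < u x \<and> u x < real (Suc j) \<longrightarrow> v x = g x" for j
  proof -
    define k where "k = real (Suc j)"
    have k: "k > 0" by (simp add: k_def)
    \<comment> \<open>The outer square makes \<open>\<psi>\<close> continuously differentiable at \<open>\<plusminus> k\<close>, beyond which it is \<open>0\<close>;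
      its derivative vanishes inside \<open>(-k, k)\<close> only at \<open>0\<close>, a value that \<open>u\<close> almost never takes.\<close>
    define \<psi> where "\<psi> = (\<lambda>s. (max 0 (k\<^sup>2 - s\<^sup>2))\<^sup>2)"
    define \<psi>' where "\<psi>' = (\<lambda>s. 2 * max 0 (k\<^sup>2 - s\<^sup>2) * (- 2 * s))"
    have psi: "(\<psi> has_real_derivative \<psi>' s) (at s)" for s
      unfolding \<psi>_def \<psi>'_def
      by (rule DERIV_chain2[OF max_0_squared_has_derivative]) (auto intro!: derivative_eq_intros)
    have cont: "continuous_on UNIV \<psi>'" unfolding \<psi>'_def by (intro continuous_intros)
    have zero: "\<psi>' s = 0" "\<psi> s = 0" if "\<bar>s\<bar> \<ge> k" for s
      using that k abs_le_square_iff[of k s] by (auto simp: \<psi>_def \<psi>'_def max_def)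
    have trunc: "trunc k s = (if \<bar>s\<bar> \<le> k then s else k * sgn s)" for s
      using k by (auto simp: trunc_def sgn_if)
    have psi_trunc: "\<psi> (trunc k s) = \<psi> s" "\<psi>' (trunc k s) = \<psi>' s" for s
      using zero[of "trunc k s"] zero[of s] k by (auto simp: trunc abs_mult sgn_if split: if_splits)
    have bd0: "\<bar>\<psi> s\<bar> \<le> k ^ 4" "\<bar>\<psi>' s\<bar> \<le> 4 * k ^ 3" for s
    proof -
      have "(max 0 (k\<^sup>2 - s\<^sup>2))\<^sup>2 \<le> (k\<^sup>2)\<^sup>2" by (intro power_mono) auto
      then show "\<bar>\<psi> s\<bar> \<le> k ^ 4" by (simp add: \<psi>_def flip: power_mult)
      show "\<bar>\<psi>' s\<bar> \<le> 4 * k ^ 3"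
      proof (cases "\<bar>s\<bar> \<ge> k")
        case True
        then show ?thesis using zero k by simp
      next
        case False
        then have "\<bar>max 0 (k\<^sup>2 - s\<^sup>2)\<bar> * \<bar>s\<bar> \<le> k\<^sup>2 * k" by (intro mult_mono) auto
        then show ?thesis by (simp add: \<psi>'_def abs_mult power2_eq_square power3_eq_cube)
      qed
    qed
    define B where "B = max (k ^ 4) (4 * k ^ 3)"
    have bd: "\<bar>\<psi> s\<bar> \<le> B" "\<bar>\<psi>' s\<bar> \<le> B" for s
      using bd0[of s] by (auto simp: B_def)
    obtain h \<phi>' where h: "has_weak_gradient \<Omega> (\<lambda>x. trunc k (u x)) h"
      and ap': "test_approximation 1 \<Omega> (\<lambda>x. trunc k (u x)) h \<phi>'"
      using W0_test_approximation[OF \<Omega> order_refl tr[OF k]] by metis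
    have hv: "AE x in ?M. h x = indicat_real {y. \<bar>u y\<bar> \<le> k} x *\<^sub>R v x"
      using v k by (intro weak_gradient_unique[OF \<Omega>(1) h]) (simp add: has_generalized_gradient_def)
    have um: "u \<in> borel_measurable ?M" using v by (simp add: has_generalized_gradient_def)
    have Lg: "L1_loc \<Omega> g" and Lh: "L1_loc \<Omega> h" using g h by (auto simp: has_weak_gradient_def)
    let ?d = "\<lambda>x. \<psi>' (u x) *\<^sub>R (g x - h x)"
    have pm: "(\<lambda>x. \<psi>' (u x)) \<in> borel_measurable ?M"
      by (rule measurable_compose[OF um borel_measurable_continuous_onI[OF cont]])
    have scaled: "L1_loc \<Omega> (\<lambda>x. \<psi>' (u x) *\<^sub>R w x)" if w: "L1_loc \<Omega> w" for w :: "'a \<Rightarrow> 'a"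
      unfolding L1_loc_def
    proof (intro conjI allI impI)
      show "(\<lambda>x. \<psi>' (u x) *\<^sub>R w x) \<in> borel_measurable ?M"
        using pm w by (intro borel_measurable_scaleR) (auto simp: L1_loc_def)
      fix K assume K: "compact K \<and> K \<subseteq> \<Omega>"
      have iw: "integrable (lebesgue_on K) w" using w K by (auto simp: L1_loc_def)
      have KO: "lebesgue_on K = restrict_space ?M K"
        using K \<Omega>(1) by (simp add: restrict_restrict_space borel_compact Int_absorb1)
      show "integrable (lebesgue_on K) (\<lambda>x. \<psi>' (u x) *\<^sub>R w x)"
      proof (rule Bochner_Integration.integrable_bound)
        show "integrable (lebesgue_on K) (\<lambda>x. B *\<^sub>R w x)" using iw by simp
        show "(\<lambda>x. \<psi>' (u x) *\<^sub>R w x) \<in> borel_measurable (lebesgue_on K)"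
          using iw measurable_restrict_space1[OF pm, of K] unfolding KO
          by (intro borel_measurable_scaleR) auto
        show "AE x in lebesgue_on K. norm (\<psi>' (u x) *\<^sub>R w x) \<le> norm (B *\<^sub>R w x)"
          using bd by (intro AE_I2) (auto intro!: mult_right_mono order_trans[OF bd(2)])
      qed
    qed
    have "AE x in ?M. \<psi>' (u x) *\<^sub>R g x - \<psi>' (u x) *\<^sub>R h x = 0"
    proof (rule fundamental_lemma_calculus_of_variations[OF \<Omega>(1) L1_loc_diff[OF scaled[OF Lg] scaled[OF Lh]]])
      fix \<eta> assume "\<eta> \<in> Cinf_c \<Omega>"
      then have \<eta>: "\<eta> \<in> C1_c \<Omega>" by (rule Cinf_c_imp_C1_c)
      note int = L1_loc_integrable_test[OF \<Omega>(1) scaled \<eta>]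
      have "(\<integral>x. \<eta> x *\<^sub>R (\<psi>' (u x) *\<^sub>R g x - \<psi>' (u x) *\<^sub>R h x) \<partial>?M)
          = (\<integral>x. \<eta> x *\<^sub>R \<psi>' (u x) *\<^sub>R g x \<partial>?M) - (\<integral>x. \<eta> x *\<^sub>R \<psi>' (u x) *\<^sub>R h x \<partial>?M)"
        unfolding Bochner_Integration.integral_diff[OF int[OF Lg] int[OF Lh], symmetric]
        by (simp add: scaleR_diff_right)
      also have "\<dots> = 0"
        using weak_chain_rule[OF \<Omega> p ap psi cont bd \<eta>] weak_chain_rule[OF \<Omega> order_refl ap' psi cont bd \<eta>]
        by (simp add: psi_trunc)
      finally show "(\<integral>x. \<eta> x *\<^sub>R (\<psi>' (u x) *\<^sub>R g x - \<psi>' (u x) *\<^sub>R h x) \<partial>?M) = 0" .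
    qed
    with hv show ?thesis
    proof eventually_elim
      case (elim x)
      show ?case
      proof
        assume ux: "0 < u x \<and> u x < real (Suc j)"
        then have "(u x)\<^sup>2 < k\<^sup>2" by (intro power_strict_mono) (auto simp: k_def)
        then have "\<psi>' (u x) \<noteq> 0" using ux by (simp add: \<psi>'_def)
        then have "g x = h x" using elim(2) by (simp flip: scaleR_diff_right)
        moreover have "\<bar>u x\<bar> \<le> k" using ux by (simp add: k_def)
        ultimately show "v x = g x" using elim(1) by simp
      qed
    qed
  qed
  then have "AE x in ?M. \<forall>j. 0 < u x \<and> u x < real (Suc j) \<longrightarrow> v x = g x"
    by (subst AE_all_countable) blast
  with pos show ?thesis
  proof eventually_elim
    case (elim x)
    obtain j where "u x < real j" using reals_Archimedean2 by blast
    then have "u x < real (Suc j)" by simp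
    with elim show ?case by blast
  qed
qed

section \<open>Poincare's inequality in the limit\<close>

text \<open>The inequality for test functions passes to the limit; the factors \<open>2\<^sup>p\<close> come from replacing the
  triangle inequality in \<open>L\<^sup>p\<close> by its cruder pointwise version \<open>powr_add_le\<close>.\<close>

lemma Poincare_W0:
  fixes \<Omega> :: "'a::euclidean_space set" and p :: real
  assumes \<Omega>: "open \<Omega>" "bounded \<Omega>" and p: "p > 1"
  obtains C where "C > 0"
    and "\<And>u g \<phi>. test_approximation p \<Omega> u g \<phi> \<Longrightarrow>
      (\<integral>x. \<bar>u x\<bar> powr p \<partial>lebesgue_on \<Omega>) \<le> C * (\<integral>x. norm (g x) powr p \<partial>lebesgue_on \<Omega>)"
proof -
  let ?M = "lebesgue_on \<Omega>"
  let ?c = "2 powr p"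
  obtain C where C: "C > 0" and PC: "\<And>\<phi>. \<phi> \<in> C1_c \<Omega> \<Longrightarrow>
      (\<integral>x. \<bar>\<phi> x\<bar> powr p \<partial>?M) \<le> C * (\<integral>x. norm (grad \<phi> x) powr p \<partial>?M)"
    using Poincare_test[OF \<Omega> p] by metis
  have p1: "p \<ge> 1" using p by simp
  have split: "norm y powr p \<le> ?c * (norm z powr p + norm (z - y) powr p)" for y z :: "'b::real_normed_vector"
  proof -
    have "norm y powr p \<le> (norm z + norm (z - y)) powr p"
      using p norm_triangle_ineq4[of z "z - y"] by (intro powr_mono2) auto
    also have "\<dots> \<le> ?c * (norm z powr p + norm (z - y) powr p)"
      by (rule powr_add_le) (use p1 in auto)
    finally show ?thesis .
  qed
  have "(\<integral>x. \<bar>u x\<bar> powr p \<partial>?M) \<le> (?c * C * ?c) * (\<integral>x. norm (g x) powr p \<partial>?M)"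
    if ap: "test_approximation p \<Omega> u g \<phi>" for u g \<phi>
  proof -
    let ?A = "\<lambda>n. \<integral>x. norm (u x - \<phi> n x) powr p \<partial>?M"
      and ?B = "\<lambda>n. \<integral>x. norm (g x - grad (\<phi> n) x) powr p \<partial>?M"
    let ?U = "\<integral>x. \<bar>u x\<bar> powr p \<partial>?M" and ?G = "\<integral>x. norm (g x) powr p \<partial>?M"
    have Lu: "L_on p \<Omega> u" and Lg: "L_on p \<Omega> g" and \<phi>: "\<And>n. \<phi> n \<in> C1_c \<Omega>"
      and A: "?A \<longlonglongrightarrow> 0" and B: "?B \<longlonglongrightarrow> 0"
      using ap Cinf_c_imp_C1_c by (auto simp: test_approximation_def)
    have L0: "L_on p \<Omega> (\<lambda>x. 0 :: real)" "L_on p \<Omega> (\<lambda>x. 0 :: 'a)"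
      by (simp_all add: L_on_def)
    note ia = L_on_diff_test(1)[OF \<Omega> p1 \<phi> Lu] and ib = L_on_diff_test(2)[OF \<Omega> p1 \<phi> Lg]
    have iphi: "integrable ?M (\<lambda>x. \<bar>\<phi> n x\<bar> powr p)"
      and igrad: "integrable ?M (\<lambda>x. norm (grad (\<phi> n) x) powr p)" for n
      using L_on_diff_test(1)[OF \<Omega> p1 \<phi> L0(1)] L_on_diff_test(2)[OF \<Omega> p1 \<phi> L0(2)] by simp_all
    have iu: "integrable ?M (\<lambda>x. \<bar>u x\<bar> powr p)" and ig: "integrable ?M (\<lambda>x. norm (g x) powr p)"
      using Lu Lg by (auto simp: L_on_def)
    have le: "?U \<le> ?c * (C * (?c * (?G + ?B n)) + ?A n)" for n
    proof -
      have "?U \<le> (\<integral>x. ?c * (\<bar>\<phi> n x\<bar> powr p + norm (u x - \<phi> n x) powr p) \<partial>?M)"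
        using split[of "u _" "\<phi> n _"] iu iphi ia by (intro integral_mono) (auto simp: abs_minus_commute)
      also have "\<dots> = ?c * ((\<integral>x. \<bar>\<phi> n x\<bar> powr p \<partial>?M) + ?A n)"
        using iphi ia by simp
      also have "(\<integral>x. \<bar>\<phi> n x\<bar> powr p \<partial>?M) \<le> C * (\<integral>x. norm (grad (\<phi> n) x) powr p \<partial>?M)"
        by (rule PC[OF \<phi>])
      also have "(\<integral>x. norm (grad (\<phi> n) x) powr p \<partial>?M)
          \<le> (\<integral>x. ?c * (norm (g x) powr p + norm (g x - grad (\<phi> n) x) powr p) \<partial>?M)"
        using ig igrad ib split[of "grad (\<phi> n) _" "g _"] by (intro integral_mono) auto
      also have "\<dots> = ?c * (?G + ?B n)" using ig ib by simp
      finally show ?thesis using C by (simp add: mult_left_mono)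
    qed
    have "(\<lambda>n. ?c * (C * (?c * (?G + ?B n)) + ?A n)) \<longlonglongrightarrow> ?c * (C * (?c * (?G + 0)) + 0)"
      by (intro tendsto_intros A B)
    then have "?U \<le> ?c * (C * (?c * (?G + 0)) + 0)"
      by (rule LIMSEQ_le_const) (intro exI allI impI le)
    then show ?thesis by (simp add: mult_ac)
  qed
  moreover have "?c * C * ?c > 0" using C by simp
  ultimately show ?thesis using that by blast
qed

section \<open>Smoothed positive parts\<close>

text \<open>A \<open>C\<^sup>1\<close> approximation of the positive part. It vanishes for \<open>s \<le> 0\<close>, so that composing it with a
  test function keeps the support compact and makes the test function nonnegative.\<close>

definition soft_pos :: "real \<Rightarrow> real \<Rightarrow> real" where
  "soft_pos \<epsilon> s = sqrt ((max 0 s)\<^sup>2 + \<epsilon>\<^sup>2) - \<epsilon>"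

definition soft_pos_deriv :: "real \<Rightarrow> real \<Rightarrow> real" where
  "soft_pos_deriv \<epsilon> s = max 0 s / sqrt ((max 0 s)\<^sup>2 + \<epsilon>\<^sup>2)"

lemma soft_pos_has_derivative:
  assumes "\<epsilon> > 0"
  shows "(soft_pos \<epsilon> has_real_derivative soft_pos_deriv \<epsilon> s) (at s)"
proof -
  have pos: "(max 0 s)\<^sup>2 + \<epsilon>\<^sup>2 > 0" using assms by (intro add_nonneg_pos) auto
  have "((\<lambda>s. (max 0 s)\<^sup>2 + \<epsilon>\<^sup>2) has_real_derivative 2 * max 0 s + 0) (at s)"
    by (intro DERIV_add max_0_squared_has_derivative DERIV_const)
  then have "((\<lambda>s. sqrt ((max 0 s)\<^sup>2 + \<epsilon>\<^sup>2)) has_real_derivative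
      inverse (sqrt ((max 0 s)\<^sup>2 + \<epsilon>\<^sup>2)) / 2 * (2 * max 0 s + 0)) (at s)"
    by (rule DERIV_chain2[where f = sqrt and g = "\<lambda>s. (max 0 s)\<^sup>2 + \<epsilon>\<^sup>2", OF DERIV_real_sqrt[OF pos]])
  then have "((\<lambda>s. sqrt ((max 0 s)\<^sup>2 + \<epsilon>\<^sup>2) - \<epsilon>) has_real_derivative
      inverse (sqrt ((max 0 s)\<^sup>2 + \<epsilon>\<^sup>2)) / 2 * (2 * max 0 s + 0) - 0) (at s)"
    by (intro DERIV_diff DERIV_const)
  moreover have "inverse r / 2 * (2 * m + 0) - 0 = m / r" for r m :: real
    by (simp add: field_simps)
  ultimately show ?thesis
    unfolding soft_pos_def[abs_def] soft_pos_deriv_def by (simp only:)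
qed

lemma soft_pos_deriv_continuous:
  assumes "\<epsilon> > 0"
  shows "continuous_on UNIV (soft_pos_deriv \<epsilon>)"
proof -
  have "sqrt ((max 0 s)\<^sup>2 + \<epsilon>\<^sup>2) \<noteq> 0" for s
    using assms by (simp add: add_nonneg_eq_0_iff)
  then show ?thesis
    unfolding soft_pos_deriv_def[abs_def] by (intro continuous_intros) auto
qed

lemma soft_pos_bounds:
  assumes "\<epsilon> > 0"
  shows "0 \<le> soft_pos \<epsilon> s" "soft_pos \<epsilon> s \<le> max 0 s"
    "0 \<le> soft_pos_deriv \<epsilon> s" "soft_pos_deriv \<epsilon> s \<le> 1"
proof -
  have "\<epsilon> \<le> sqrt ((max 0 s)\<^sup>2 + \<epsilon>\<^sup>2)" by (rule real_le_rsqrt) simp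
  then show "0 \<le> soft_pos \<epsilon> s" by (simp add: soft_pos_def)
  have "sqrt ((max 0 s)\<^sup>2 + \<epsilon>\<^sup>2) \<le> sqrt ((max 0 s)\<^sup>2) + sqrt (\<epsilon>\<^sup>2)"
    by (rule sqrt_add_le_add_sqrt) auto
  then show "soft_pos \<epsilon> s \<le> max 0 s" using assms by (simp add: soft_pos_def)
  show "0 \<le> soft_pos_deriv \<epsilon> s" by (simp add: soft_pos_deriv_def)
  have "max 0 s \<le> sqrt ((max 0 s)\<^sup>2 + \<epsilon>\<^sup>2)" by (rule real_le_rsqrt) simp
  moreover have "sqrt ((max 0 s)\<^sup>2 + \<epsilon>\<^sup>2) > 0"
    using assms by (intro real_sqrt_gt_zero add_nonneg_pos) auto
  ultimately show "soft_pos_deriv \<epsilon> s \<le> 1" by (simp add: soft_pos_deriv_def)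
qed

lemma soft_pos_tendsto:
  assumes "t > 0" and s: "s \<longlonglongrightarrow> t" and e: "\<epsilon> \<longlonglongrightarrow> 0"
  shows "(\<lambda>n. soft_pos (\<epsilon> n) (s n)) \<longlonglongrightarrow> t" and "(\<lambda>n. soft_pos_deriv (\<epsilon> n) (s n)) \<longlonglongrightarrow> 1"
proof -
  have root: "(\<lambda>n. sqrt ((max 0 (s n))\<^sup>2 + (\<epsilon> n)\<^sup>2)) \<longlonglongrightarrow> sqrt ((max 0 t)\<^sup>2 + 0\<^sup>2)"
    by (intro tendsto_intros s e)
  have "(\<lambda>n. soft_pos (\<epsilon> n) (s n)) \<longlonglongrightarrow> sqrt ((max 0 t)\<^sup>2 + 0\<^sup>2) - 0"
    unfolding soft_pos_def by (intro tendsto_diff root e)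
  then show "(\<lambda>n. soft_pos (\<epsilon> n) (s n)) \<longlonglongrightarrow> t" using assms(1) by simp
  have "(\<lambda>n. soft_pos_deriv (\<epsilon> n) (s n)) \<longlonglongrightarrow> max 0 t / sqrt ((max 0 t)\<^sup>2 + 0\<^sup>2)"
    unfolding soft_pos_deriv_def using assms(1) by (intro tendsto_divide root tendsto_intros s) auto
  then show "(\<lambda>n. soft_pos_deriv (\<epsilon> n) (s n)) \<longlonglongrightarrow> 1" using assms(1) by simp
qed

lemma soft_pos_test:
  assumes "\<epsilon> > 0" and \<phi>: "\<phi> \<in> C1_c \<Omega>"
  shows "(\<lambda>x. soft_pos \<epsilon> (\<phi> x)) \<in> C1_c \<Omega>"
    and "grad (\<lambda>x. soft_pos \<epsilon> (\<phi> x)) = (\<lambda>x. soft_pos_deriv \<epsilon> (\<phi> x) *\<^sub>R grad \<phi> x)"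
proof -
  note comp = C1_compose[OF C1_cD[OF \<phi>] soft_pos_has_derivative[OF assms(1)]
      soft_pos_deriv_continuous[OF assms(1)]]
  have "compact_support_in \<Omega> \<phi>" using \<phi> by (simp add: C1_c_def)
  then have "compact_support_in \<Omega> (\<lambda>x. soft_pos \<epsilon> (\<phi> x))"
    by (rule compact_support_in_mono) (use assms(1) in \<open>simp add: soft_pos_def\<close>)
  with comp(1) show "(\<lambda>x. soft_pos \<epsilon> (\<phi> x)) \<in> C1_c \<Omega>"
    unfolding C1_c_def by blast
  show "grad (\<lambda>x. soft_pos \<epsilon> (\<phi> x)) = (\<lambda>x. soft_pos_deriv \<epsilon> (\<phi> x) *\<^sub>R grad \<phi> x)"
    by (rule comp(2))
qed

section \<open>The singular term\<close>

lemma L1_loc_ereal_finite: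
  fixes \<Omega> :: "'a::euclidean_space set"
  assumes \<Omega>: "open \<Omega>" and F: "L1_loc_ereal \<Omega> F"
  shows "AE x in lebesgue_on \<Omega>. \<bar>F x\<bar> \<noteq> \<infinity>"
proof -
  obtain \<D> where D: "countable \<D>" "\<D> \<subseteq> Pow \<Omega>" "\<And>X. X \<in> \<D> \<Longrightarrow> \<exists>a b. X = cbox a b" "\<Union>\<D> = \<Omega>"
    using open_countable_Union_open_cbox[OF \<Omega>] by metis
  have "AE x in lebesgue. x \<in> X \<longrightarrow> \<bar>F x\<bar> \<noteq> \<infinity>" if X: "X \<in> \<D>" for X
  proof -
    have K: "compact X" "X \<subseteq> \<Omega>" using D(2) D(3)[OF X] X compact_cbox by auto
    have KO: "lebesgue_on X = restrict_space (lebesgue_on \<Omega>) X"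
      using K \<Omega> by (simp add: restrict_restrict_space borel_compact Int_absorb1)
    have [measurable]: "F \<in> borel_measurable (lebesgue_on X)"
      unfolding KO using F by (rule measurable_restrict_space1[OF conjunct1[OF L1_loc_ereal_def[THEN iffD1]]])
    have "(\<integral>\<^sup>+x. e2ennreal \<bar>F x\<bar> \<partial>lebesgue_on X) \<noteq> \<infinity>"
      using F K by (auto simp: L1_loc_ereal_def)
    then have "AE x in lebesgue_on X. e2ennreal \<bar>F x\<bar> \<noteq> \<infinity>"
      by (intro nn_integral_PInf_AE) auto
    then have "AE x in lebesgue_on X. \<bar>F x\<bar> \<noteq> \<infinity>"
      by eventually_elim auto
    then show ?thesis
      using K by (subst (asm) AE_restrict_space_iff) (auto simp: borel_compact)
  qed
  then have "AE x in lebesgue. \<forall>X\<in>\<D>. x \<in> X \<longrightarrow> \<bar>F x\<bar> \<noteq> \<infinity>"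
    by (subst AE_ball_countable[OF D(1)]) blast
  then show ?thesis
    using \<Omega> D(4) by (subst AE_restrict_space_iff) (auto elim!: eventually_mono)
qed

lemma L1_loc_real_of_ereal:
  fixes \<Omega> :: "'a::euclidean_space set"
  assumes \<Omega>: "open \<Omega>" and F: "L1_loc_ereal \<Omega> F"
  shows "L1_loc \<Omega> (\<lambda>x. real_of_ereal (F x))"
  unfolding L1_loc_def
proof (intro conjI allI impI)
  have F_m: "F \<in> borel_measurable (lebesgue_on \<Omega>)" using F by (simp add: L1_loc_ereal_def)
  then show "(\<lambda>x. real_of_ereal (F x)) \<in> borel_measurable (lebesgue_on \<Omega>)" by simp
  fix X assume K: "compact X \<and> X \<subseteq> \<Omega>"
  have KO: "lebesgue_on X = restrict_space (lebesgue_on \<Omega>) X"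
    using K \<Omega> by (simp add: restrict_restrict_space borel_compact Int_absorb1)
  have [measurable]: "F \<in> borel_measurable (lebesgue_on X)"
    unfolding KO by (rule measurable_restrict_space1[OF F_m])
  have "ennreal (norm (real_of_ereal y)) \<le> e2ennreal \<bar>y\<bar>" for y
    by (cases y) simp_all
  then have "(\<integral>\<^sup>+x. ennreal (norm (real_of_ereal (F x))) \<partial>lebesgue_on X)
      \<le> (\<integral>\<^sup>+x. e2ennreal \<bar>F x\<bar> \<partial>lebesgue_on X)"
    by (intro nn_integral_mono)
  also have "\<dots> < \<infinity>" using F K by (simp add: L1_loc_ereal_def)
  finally show "integrable (lebesgue_on X) (\<lambda>x. real_of_ereal (F x))"
    by (intro integrableI_bounded) auto
qed

text \<open>Where \<open>u\<close> vanishes the singular term is \<open>a \<cdot> \<infinity> = \<infinity>\<close>, which local integrability excludes outside a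
  null set.\<close>

lemma solution_positive:
  fixes \<Omega> :: "'a::euclidean_space set"
  assumes "open \<Omega>" and "c0 > 0" and a: "AE x in lebesgue_on \<Omega>. a x \<ge> c0"
    and nonneg: "AE x in lebesgue_on \<Omega>. u x \<ge> 0" and sing: "L1_loc_ereal \<Omega> (singular_term a \<gamma> u)"
  shows "AE x in lebesgue_on \<Omega>. u x > 0"
  using a nonneg L1_loc_ereal_finite[OF assms(1) sing]
proof eventually_elim
  case (elim x)
  then have "u x \<noteq> 0" using assms(2) by (auto simp: singular_term_def)
  with elim show ?case by simp
qed

section \<open>The energy inequality\<close>

text \<open>Here \<open>g\<close> is the limit gradient, \<open>d\<close> the gradient of a test function and \<open>t\<close> the derivative of the
  smoothed positive part. Writing \<open>d = g - (g - d)\<close> isolates the energy density \<open>|g|\<^sup>p\<close> and an error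
  that vanishes with \<open>g - d\<close>.\<close>

lemma p_Laplace_flux_lower_bound:
  fixes g d :: "'a::real_inner"
  assumes "0 \<le> t" and "t \<le> 1"
  shows "t * norm g powr p - norm g powr (p - 1) * norm (g - d) \<le> norm g powr (p - 2) * (g \<bullet> (t *\<^sub>R d))"
proof (cases "g = 0")
  case False
  then have n: "norm g > 0" by simp
  have sq: "norm g powr (p - 2) * (g \<bullet> g) = norm g powr p"
    using n by (simp add: powr_diff dot_square_norm)
  have lin: "norm g powr (p - 2) * norm g = norm g powr (p - 1)"
    using n powr_mult_base[of "norm g" "p - 2"] by (simp add: mult.commute)
  have "norm g powr (p - 2) * (g \<bullet> (g - d)) \<le> norm g powr (p - 2) * (norm g * norm (g - d))"
    by (intro mult_left_mono norm_cauchy_schwarz) auto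
  then have le: "norm g powr (p - 2) * (g \<bullet> (g - d)) \<le> norm g powr (p - 1) * norm (g - d)"
    using lin by (simp add: mult.assoc flip: lin)
  have "t * (norm g powr (p - 2) * (g \<bullet> (g - d))) \<le> t * (norm g powr (p - 1) * norm (g - d))"
    using le assms by (intro mult_left_mono)
  also have "\<dots> \<le> norm g powr (p - 1) * norm (g - d)"
    using assms by (intro mult_left_le_one_le) auto
  finally show ?thesis
    using sq by (simp add: inner_diff_right algebra_simps)
qed simp

text \<open>Supplies an integrable majorant of the flux term.\<close>

lemma p_Laplace_flux_bound:
  fixes g d :: "'a::real_inner"
  assumes "0 \<le> t" and "t \<le> 1"
  shows "\<bar>norm g powr (p - 2) * (g \<bullet> (t *\<^sub>R d))\<bar> \<le> norm g powr (p - 1) * norm (g - d) + norm g powr p"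
proof (cases "g = 0")
  case False
  then have n: "norm g > 0" by simp
  have lin: "norm g powr (p - 2) * norm g = norm g powr (p - 1)"
    using n powr_mult_base[of "norm g" "p - 2"] by (simp add: mult.commute)
  have lin': "norm g powr (p - 1) * norm g = norm g powr p"
    using n powr_mult_base[of "norm g" "p - 1"] by (simp add: mult.commute)
  have "norm (t *\<^sub>R d) \<le> norm d" using assms by (simp add: mult_left_le_one_le)
  also have "\<dots> \<le> norm (g - d) + norm g" using norm_triangle_ineq4[of g "g - d"] by simp
  finally have d: "norm (t *\<^sub>R d) \<le> norm (g - d) + norm g" .
  have "\<bar>norm g powr (p - 2) * (g \<bullet> (t *\<^sub>R d))\<bar> \<le> norm g powr (p - 2) * (norm g * norm (t *\<^sub>R d))"
    unfolding abs_mult by (intro mult_mono Cauchy_Schwarz_ineq2) auto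
  also have "\<dots> = norm g powr (p - 1) * norm (t *\<^sub>R d)" by (simp only: lin flip: mult.assoc)
  also have "\<dots> \<le> norm g powr (p - 1) * (norm (g - d) + norm g)"
    by (intro mult_left_mono d) auto
  also have "\<dots> = norm g powr (p - 1) * norm (g - d) + norm g powr p"
    by (simp add: distrib_left lin')
  finally show ?thesis .
qed simp

text \<open>With the test function \<open>w\<^sub>n\<close> obtained from \<open>\<phi>\<^sub>n\<close> by the smoothed positive part, the three terms of the
  equation are estimated separately. The flux term is at least \<open>\<integral> t\<^sub>n |g|\<^sup>p\<close> minus an error that tends
  to \<open>0\<close>, where \<open>t\<^sub>n \<rightarrow> 1\<close> because \<open>u > 0\<close>. The right-hand side is at most \<open>\<mu> M \<integral> u\<close> plus an error,
  as \<open>w\<^sub>n \<le> u + |u - \<phi>\<^sub>n|\<close>. The singular term is at least \<open>c\<^sub>0 \<integral> u\<^sup>-\<^sup>\<gamma> min w\<^sub>n u\<close>; cutting \<open>w\<^sub>n\<close> off at \<open>u\<close>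
  provides the majorant \<open>u\<^sup>1\<^sup>-\<^sup>\<gamma>\<close>, so that dominated convergence yields \<open>c\<^sub>0 \<integral> u\<^sup>1\<^sup>-\<^sup>\<gamma>\<close>.\<close>

lemma energy_inequality:
  fixes \<Omega> :: "'a::euclidean_space set"
  assumes \<Omega>: "open \<Omega>" "bounded \<Omega>" and p: "p > 1" and \<gamma>: "0 < \<gamma>" "\<gamma> < 1"
    and c0: "c0 > 0" and a: "AE x in lebesgue_on \<Omega>. a x \<ge> c0"
    and f: "f \<in> borel_measurable (lebesgue_on \<Omega>)" and fM: "AE x in lebesgue_on \<Omega>. \<bar>f x\<bar> \<le> M" and M: "M > 0"
    and \<mu>: "\<mu> > 0"
    and ap: "test_approximation p \<Omega> u g \<phi>"
    and pos: "AE x in lebesgue_on \<Omega>. u x > 0" and vg: "AE x in lebesgue_on \<Omega>. v x = g x"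
    and v: "v \<in> borel_measurable (lebesgue_on \<Omega>)"
    and sing: "L1_loc_ereal \<Omega> (singular_term a \<gamma> u)"
    and eq: "\<And>\<phi>. \<phi> \<in> C1_c \<Omega> \<Longrightarrow>
           (\<integral>x. norm (v x) powr (p - 2) * (v x \<bullet> grad \<phi> x) \<partial>lebesgue_on \<Omega>)
           + (\<integral>x. real_of_ereal (singular_term a \<gamma> u x) * \<phi> x \<partial>lebesgue_on \<Omega>)
           = \<mu> * (\<integral>x. f x * \<phi> x \<partial>lebesgue_on \<Omega>)"
  shows "integrable (lebesgue_on \<Omega>) (\<lambda>x. u x powr (1 - \<gamma>))"
    and "(\<integral>x. norm (g x) powr p \<partial>lebesgue_on \<Omega>) + c0 * (\<integral>x. u x powr (1 - \<gamma>) \<partial>lebesgue_on \<Omega>)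
      \<le> \<mu> * M * (\<integral>x. u x \<partial>lebesgue_on \<Omega>)"
proof -
  let ?M = "lebesgue_on \<Omega>"
  interpret finite_measure ?M by (rule finite_measure_bounded_open[OF \<Omega>])
  have p1: "p \<ge> 1" using p by simp
  note L1 = test_approximation_L1[OF \<Omega> p1 ap]
  have Lu: "L_on p \<Omega> u" and Lg: "L_on p \<Omega> g" and \<phi>: "\<And>n. \<phi> n \<in> C1_c \<Omega>"
    and B: "(\<lambda>n. \<integral>x. norm (g x - grad (\<phi> n) x) powr p \<partial>?M) \<longlonglongrightarrow> 0"
    and \<phi>u: "AE x in ?M. (\<lambda>n. \<phi> n x) \<longlonglongrightarrow> u x"
    using ap Cinf_c_imp_C1_c by (auto simp: test_approximation_def)
  have [measurable]: "u \<in> borel_measurable ?M" "g \<in> borel_measurable ?M" "v \<in> borel_measurable ?M"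
    "f \<in> borel_measurable ?M"
    "\<And>n. \<phi> n \<in> borel_measurable ?M" "\<And>n. grad (\<phi> n) \<in> borel_measurable ?M"
    using L1(1,2) C1_c_measurable[OF \<phi>] v f by auto
  have ig: "integrable ?M (\<lambda>x. norm (g x) powr p)" using Lg by (simp add: L_on_def)
  have "s powr (1 - \<gamma>) \<le> 1 + s" if "s > 0" for s :: real
  proof (cases "s \<le> 1")
    case True
    then have "s powr (1 - \<gamma>) \<le> 1" using that \<gamma> by (intro powr_le1) auto
    with that show ?thesis by simp
  next
    case False
    then have "s powr (1 - \<gamma>) \<le> s powr 1" using \<gamma> by (intro powr_mono) auto
    with that show ?thesis by simp
  qed
  then have "AE x in ?M. norm (u x powr (1 - \<gamma>)) \<le> norm (1 + u x)"
    using pos by (auto elim!: eventually_mono)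
  then show iU: "integrable ?M (\<lambda>x. u x powr (1 - \<gamma>))"
    by (rule Bochner_Integration.integrable_bound[rotated 2]) (use L1(1) in simp_all)
  define \<epsilon> where "\<epsilon> = (\<lambda>n. inverse (real (Suc n)))"
  have \<epsilon>: "\<epsilon> n > 0" "\<epsilon> \<longlonglongrightarrow> 0" for n
    using LIMSEQ_inverse_real_of_nat by (auto simp: \<epsilon>_def)
  define w where "w = (\<lambda>n x. soft_pos (\<epsilon> n) (\<phi> n x))"
  define t where "t = (\<lambda>n x. soft_pos_deriv (\<epsilon> n) (\<phi> n x))"
  have w: "w n \<in> C1_c \<Omega>" and grad_w: "grad (w n) = (\<lambda>x. t n x *\<^sub>R grad (\<phi> n) x)" for n
    unfolding w_def t_def using soft_pos_test[OF \<epsilon>(1) \<phi>] by auto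
  have t: "0 \<le> t n x" "t n x \<le> 1" and w_nonneg: "0 \<le> w n x" and w_le: "w n x \<le> max 0 (\<phi> n x)" for n x
    unfolding t_def w_def using soft_pos_bounds[OF \<epsilon>(1)] by auto
  have [measurable]: "w n \<in> borel_measurable ?M" for n using C1_c_measurable(1)[OF w] .
  have [measurable]: "t n \<in> borel_measurable ?M" for n
    unfolding t_def
    using borel_measurable_continuous_onI[OF soft_pos_deriv_continuous[OF \<epsilon>(1)]]
    by (rule measurable_compose[rotated]) simp
  have lim_w: "AE x in ?M. (\<lambda>n. w n x) \<longlonglongrightarrow> u x" and lim_t: "AE x in ?M. (\<lambda>n. t n x) \<longlonglongrightarrow> 1"
  proof -
    show "AE x in ?M. (\<lambda>n. w n x) \<longlonglongrightarrow> u x"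
      using pos \<phi>u unfolding w_def by eventually_elim (rule soft_pos_tendsto(1)[OF _ _ \<epsilon>(2)])
    show "AE x in ?M. (\<lambda>n. t n x) \<longlonglongrightarrow> 1"
      using pos \<phi>u unfolding t_def by eventually_elim (rule soft_pos_tendsto(2)[OF _ _ \<epsilon>(2)])
  qed
  let ?H = "\<lambda>n x. norm (g x) powr (p - 1) * norm (g x - grad (\<phi> n) x)"
  have H: "integrable ?M (?H n)" "(\<lambda>n. integral\<^sup>L ?M (?H n)) \<longlonglongrightarrow> 0" for n
    by (rule integral_Holder_tendsto_zero[OF p1];
        use ig L_on_diff_test(2)[OF \<Omega> p1 \<phi> Lg] B in simp)+
  let ?T = "\<lambda>n x. t n x * norm (g x) powr p"
  have "AE x in ?M. (\<lambda>n. ?T n x) \<longlonglongrightarrow> 1 * norm (g x) powr p"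
    using lim_t by eventually_elim (intro tendsto_intros)
  then have T_AE: "AE x in ?M. (\<lambda>n. ?T n x) \<longlonglongrightarrow> norm (g x) powr p" by simp
  have T_le: "AE x in ?M. norm (?T n x) \<le> norm (g x) powr p" for n
    using t by (intro AE_I2) (auto simp: abs_mult intro: mult_left_le_one_le)
  have T_lim: "(\<lambda>n. integral\<^sup>L ?M (?T n)) \<longlonglongrightarrow> (\<integral>x. norm (g x) powr p \<partial>?M)"
    by (rule integral_dominated_convergence[OF _ _ ig T_AE T_le]) measurable
  have T_int: "integrable ?M (?T n)" for n
    by (rule integrable_dominated_convergence2[OF _ _ ig T_AE T_le]) measurable
  let ?S = "\<lambda>n x. u x powr (- \<gamma>) * min (w n x) (u x)"
  have powr_eq: "s powr (- \<gamma>) * s = s powr (1 - \<gamma>)" if "s > 0" for s :: real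
    using that powr_mult_base[of s "- \<gamma>"] by (simp add: mult.commute)
  have S_AE: "AE x in ?M. (\<lambda>n. ?S n x) \<longlonglongrightarrow> u x powr (1 - \<gamma>)"
    using lim_w pos
  proof eventually_elim
    case (elim x)
    have "(\<lambda>n. ?S n x) \<longlonglongrightarrow> u x powr (- \<gamma>) * min (u x) (u x)"
      by (intro tendsto_intros elim)
    then show ?case using powr_eq elim by simp
  qed
  have S_le: "AE x in ?M. norm (?S n x) \<le> u x powr (1 - \<gamma>)" for n
    using pos
  proof eventually_elim
    case (elim x)
    have "norm (?S n x) = u x powr (- \<gamma>) * min (w n x) (u x)"
      using elim w_nonneg[of n x] by (simp add: abs_mult)
    also have "\<dots> \<le> u x powr (- \<gamma>) * u x" by (intro mult_left_mono) auto
    finally show ?case using powr_eq elim by simp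
  qed
  have S_lim: "(\<lambda>n. integral\<^sup>L ?M (?S n)) \<longlonglongrightarrow> (\<integral>x. u x powr (1 - \<gamma>) \<partial>?M)"
    by (rule integral_dominated_convergence[OF _ _ iU S_AE S_le]) measurable
  have S_int: "integrable ?M (?S n)" for n
    by (rule integrable_dominated_convergence2[OF _ _ iU S_AE S_le]) measurable
  let ?D = "\<lambda>n. \<integral>x. \<bar>u x - \<phi> n x\<bar> \<partial>?M"
  have le: "integral\<^sup>L ?M (?T n) - integral\<^sup>L ?M (?H n) + c0 * integral\<^sup>L ?M (?S n)
      \<le> \<mu> * (M * (integral\<^sup>L ?M u + ?D n))" for n
  proof -
    let ?F = "\<lambda>x. norm (g x) powr (p - 2) * (g x \<bullet> (t n x *\<^sub>R grad (\<phi> n) x))"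
    let ?h = "\<lambda>x. real_of_ereal (singular_term a \<gamma> u x)"
    have F_int: "integrable ?M ?F"
    proof (rule Bochner_Integration.integrable_bound)
      show "integrable ?M (\<lambda>x. ?H n x + norm (g x) powr p)" using H(1) ig by simp
      show "AE x in ?M. norm (?F x) \<le> norm (?H n x + norm (g x) powr p)"
        using p_Laplace_flux_bound[OF t] by (intro AE_I2) (simp del: inner_scaleR_right)
    qed measurable
    have "integral\<^sup>L ?M (?T n) - integral\<^sup>L ?M (?H n) = (\<integral>x. ?T n x - ?H n x \<partial>?M)"
      using T_int H(1) by simp
    also have "\<dots> \<le> integral\<^sup>L ?M ?F"
      using T_int H(1) F_int p_Laplace_flux_lower_bound[OF t] by (intro integral_mono) auto
    also have "\<dots> = (\<integral>x. norm (v x) powr (p - 2) * (v x \<bullet> grad (w n) x) \<partial>?M)"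
      unfolding grad_w by (rule integral_cong_AE) (use vg in \<open>auto elim!: eventually_mono\<close>)
    finally have I1: "integral\<^sup>L ?M (?T n) - integral\<^sup>L ?M (?H n)
        \<le> (\<integral>x. norm (v x) powr (p - 2) * (v x \<bullet> grad (w n) x) \<partial>?M)" .
    have hw: "integrable ?M (\<lambda>x. ?h x * w n x)"
      using L1_loc_integrable_test[OF \<Omega>(1) L1_loc_real_of_ereal[OF \<Omega>(1) sing] w]
      by (simp add: mult.commute)
    have "c0 * integral\<^sup>L ?M (?S n) = (\<integral>x. c0 * ?S n x \<partial>?M)" by simp
    also have "\<dots> \<le> (\<integral>x. ?h x * w n x \<partial>?M)"
    proof (rule integral_mono_AE)
      show "AE x in ?M. c0 * ?S n x \<le> ?h x * w n x"
        using pos a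
      proof eventually_elim
        case (elim x)
        have "c0 * ?S n x = (c0 * u x powr (- \<gamma>)) * min (w n x) (u x)" by simp
        also have "\<dots> \<le> (a x * u x powr (- \<gamma>)) * w n x"
          using elim c0 w_nonneg[of n x] by (intro mult_mono mult_right_mono) auto
        also have "a x * u x powr (- \<gamma>) = ?h x" using elim by (simp add: singular_term_def)
        finally show ?case .
      qed
    qed (use S_int hw in auto)
    finally have I2: "c0 * integral\<^sup>L ?M (?S n) \<le> (\<integral>x. ?h x * w n x \<partial>?M)" .
    have i3: "integrable ?M (\<lambda>x. \<bar>u x - \<phi> n x\<bar>)"
      using integrable_if_powr_integrable[OF finite_measure_axioms p1, of "\<lambda>x. u x - \<phi> n x"]
        L_on_diff_test(1)[OF \<Omega> p1 \<phi> Lu] by simp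
    have fw_le: "AE x in ?M. \<bar>f x * w n x\<bar> \<le> M * (u x + \<bar>u x - \<phi> n x\<bar>)"
      using fM pos
    proof eventually_elim
      case (elim x)
      have "w n x \<le> u x + \<bar>u x - \<phi> n x\<bar>" using w_le[of n x] elim by (auto simp: max_def split: if_splits)
      then show ?case
        using elim w_nonneg[of n x] M unfolding abs_mult by (intro mult_mono) auto
    qed
    have bound_int: "integrable ?M (\<lambda>x. M * (u x + \<bar>u x - \<phi> n x\<bar>))" using i3 L1(1) by simp
    have "(\<integral>x. f x * w n x \<partial>?M) \<le> (\<integral>x. M * (u x + \<bar>u x - \<phi> n x\<bar>) \<partial>?M)"
    proof (rule integral_mono_AE[OF _ bound_int])
      show "integrable ?M (\<lambda>x. f x * w n x)"
        by (rule Bochner_Integration.integrable_bound[OF bound_int])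
           (use fw_le in \<open>auto elim!: eventually_mono\<close>)
      show "AE x in ?M. f x * w n x \<le> M * (u x + \<bar>u x - \<phi> n x\<bar>)"
        using fw_le by eventually_elim linarith
    qed
    also have "\<dots> = M * (integral\<^sup>L ?M u + ?D n)" using i3 L1(1) by simp
    finally have I3: "\<mu> * (\<integral>x. f x * w n x \<partial>?M) \<le> \<mu> * (M * (integral\<^sup>L ?M u + ?D n))"
      using \<mu> by simp
    from I1 I2 I3 eq[OF w[of n]] show ?thesis by linarith
  qed
  have "(\<integral>x. norm (g x) powr p \<partial>?M) - 0 + c0 * (\<integral>x. u x powr (1 - \<gamma>) \<partial>?M)
      \<le> \<mu> * (M * (integral\<^sup>L ?M u + 0))"
  proof (rule LIMSEQ_le)
    show "(\<lambda>n. integral\<^sup>L ?M (?T n) - integral\<^sup>L ?M (?H n) + c0 * integral\<^sup>L ?M (?S n)) \<longlonglongrightarrow>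
        (\<integral>x. norm (g x) powr p \<partial>?M) - 0 + c0 * (\<integral>x. u x powr (1 - \<gamma>) \<partial>?M)"
      by (intro tendsto_intros T_lim H(2) S_lim)
    show "(\<lambda>n. \<mu> * (M * (integral\<^sup>L ?M u + ?D n))) \<longlonglongrightarrow> \<mu> * (M * (integral\<^sup>L ?M u + 0))"
      by (intro tendsto_intros L1(3))
    show "\<exists>N. \<forall>n\<ge>N. integral\<^sup>L ?M (?T n) - integral\<^sup>L ?M (?H n) + c0 * integral\<^sup>L ?M (?S n)
      \<le> \<mu> * (M * (integral\<^sup>L ?M u + ?D n))" using le by blast
  qed
  then show "(\<integral>x. norm (g x) powr p \<partial>?M) + c0 * (\<integral>x. u x powr (1 - \<gamma>) \<partial>?M)
      \<le> \<mu> * M * (\<integral>x. u x \<partial>?M)" by simp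
qed

section \<open>Nonexistence of finite energy solutions\<close>

lemma le_add_powr:
  fixes s :: real
  assumes "s > 0" "0 < \<gamma>" "p \<ge> 1"
  shows "s \<le> s powr (1 - \<gamma>) + s powr p"
proof (cases "s \<le> 1")
  case True
  then have "s powr 1 \<le> s powr (1 - \<gamma>)" using assms by (intro powr_mono') auto
  then show ?thesis using assms by (simp add: add_increasing2)
next
  case False
  then have "s powr 1 \<le> s powr p" using assms by (intro powr_mono) auto
  then show ?thesis using assms by (simp add: add_increasing)
qed

theorem theorem2p4:
  fixes \<Omega> :: "(real ^ 'n) set" and p \<gamma> :: real and a f :: "real ^ 'n \<Rightarrow> real"
  assumes "CARD('n) \<ge> 2"
    and "open \<Omega>" and "bounded \<Omega>" and "\<Omega> \<noteq> {}" and "smooth_boundary \<Omega>"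
    and "p > 1" and "0 < \<gamma>" and "\<gamma> < 1"
    and "integrable (lebesgue_on \<Omega>) a"
    and "\<exists>c0>0. AE x in lebesgue_on \<Omega>. a x \<ge> c0"
    and "Linf_on \<Omega> f" and "AE x in lebesgue_on \<Omega>. f x \<ge> 0"
  shows "\<exists>\<mu>0>0. \<forall>\<mu>. 0 < \<mu> \<and> \<mu> < \<mu>0 \<longrightarrow> \<not> (\<exists>u. finite_energy_solution \<Omega> p \<gamma> a f \<mu> u)"
proof -
  let ?M = "lebesgue_on \<Omega>"
  note \<Omega> = \<open>open \<Omega>\<close> \<open>bounded \<Omega>\<close>
  have p: "p > 1" "p \<ge> 1" using \<open>p > 1\<close> by auto
  obtain c0 where c0: "c0 > 0" "AE x in ?M. a x \<ge> c0" using assms by blast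
  obtain M' where f: "f \<in> borel_measurable ?M" and M': "AE x in ?M. \<bar>f x\<bar> \<le> M'"
    using \<open>Linf_on \<Omega> f\<close> by (auto simp: Linf_on_def)
  define M where "M = max M' 1"
  have M: "M > 0" "AE x in ?M. \<bar>f x\<bar> \<le> M"
    using M' by (auto simp: M_def elim!: eventually_mono)
  obtain C where C: "C > 0" and Poincare: "\<And>u g \<phi>. test_approximation p \<Omega> u g \<phi> \<Longrightarrow>
      (\<integral>x. \<bar>u x\<bar> powr p \<partial>?M) \<le> C * (\<integral>x. norm (g x) powr p \<partial>?M)"
    using Poincare_W0[OF \<Omega> p(1)] by metis
  define \<mu>0 where "\<mu>0 = min (1 / (M * C)) (c0 / M)"
  have "\<mu>0 > 0" using M(1) C c0(1) by (simp add: \<mu>0_def)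
  moreover have False if \<mu>: "0 < \<mu>" "\<mu> < \<mu>0" and fes: "finite_energy_solution \<Omega> p \<gamma> a f \<mu> u" for \<mu> u
  proof -
    have sol: "solution \<Omega> p \<gamma> a f \<mu> u" and "W0 p \<Omega> u"
      using fes by (auto simp: finite_energy_solution_def)
    then obtain g \<phi> where g: "has_weak_gradient \<Omega> u g" and ap: "test_approximation p \<Omega> u g \<phi>"
      using W0_test_approximation[OF \<Omega> p(2)] by metis
    from sol obtain v where u0: "AE x in ?M. u x \<ge> 0"
      and tr: "\<And>k. k > 0 \<Longrightarrow> W0 1 \<Omega> (\<lambda>x. trunc k (u x))"
      and v: "has_generalized_gradient \<Omega> u v"
      and sing: "L1_loc_ereal \<Omega> (singular_term a \<gamma> u)"
      and eq: "\<And>\<phi>. \<phi> \<in> C1_c \<Omega> \<Longrightarrow>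
           (\<integral>x. norm (v x) powr (p - 2) * (v x \<bullet> grad \<phi> x) \<partial>?M)
           + (\<integral>x. real_of_ereal (singular_term a \<gamma> u x) * \<phi> x \<partial>?M)
           = \<mu> * (\<integral>x. f x * \<phi> x \<partial>?M)"
      unfolding solution_def by blast
    have pos: "AE x in ?M. u x > 0" by (rule solution_positive[OF \<Omega>(1) c0 u0 sing])
    have vg: "AE x in ?M. v x = g x"
      by (rule generalized_gradient_eq_weak_gradient[OF \<Omega> p(2) ap g v tr pos])
    have vm: "v \<in> borel_measurable ?M" using v by (simp add: has_generalized_gradient_def)
    let ?U = "\<integral>x. u x powr (1 - \<gamma>) \<partial>?M" and ?G = "\<integral>x. norm (g x) powr p \<partial>?M"
    note energy = energy_inequality[OF \<Omega> p(1) \<open>0 < \<gamma>\<close> \<open>\<gamma> < 1\<close> c0 f M(2,1) \<mu>(1) ap pos vg vm sing eq]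
    have iu: "integrable ?M u" by (rule test_approximation_L1[OF \<Omega> p(2) ap])
    have iup: "integrable ?M (\<lambda>x. \<bar>u x\<bar> powr p)"
      using ap by (simp add: test_approximation_def L_on_def)
    have "(\<integral>x. u x \<partial>?M) \<le> (\<integral>x. u x powr (1 - \<gamma>) + \<bar>u x\<bar> powr p \<partial>?M)"
      using iu iup energy(1) pos le_add_powr[OF _ \<open>0 < \<gamma>\<close> p(2)]
      by (intro integral_mono_AE) (auto elim!: eventually_mono)
    also have "\<dots> = ?U + (\<integral>x. \<bar>u x\<bar> powr p \<partial>?M)" using iup energy(1) by simp
    also have "\<dots> \<le> ?U + C * ?G" using Poincare[OF ap] by simp
    finally have "\<mu> * M * (\<integral>x. u x \<partial>?M) \<le> \<mu> * M * (?U + C * ?G)"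
      using \<mu>(1) M(1) by (intro mult_left_mono) auto
    with energy(2) have key: "?G + c0 * ?U \<le> \<mu> * M * ?U + \<mu> * M * C * ?G"
      by (simp add: algebra_simps)
    have "\<mu> < 1 / (M * C)" "\<mu> < c0 / M" using \<mu>(2) by (auto simp: \<mu>0_def)
    then have small: "\<mu> * M * C < 1" "\<mu> * M < c0"
      using M(1) C by (simp_all add: field_simps)
    have "?G \<ge> 0" "?U \<ge> 0" by simp_all
    then have "\<mu> * M * C * ?G \<le> 1 * ?G" using small by (intro mult_right_mono) auto
    with key have "c0 * ?U \<le> \<mu> * M * ?U" by simp
    then have "\<not> ?U > 0" using mult_strict_right_mono[OF small(2), of ?U] by linarith
    with \<open>?U \<ge> 0\<close> have "?U = 0" by linarith
    then have "AE x in ?M. u x powr (1 - \<gamma>) = 0"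
      using energy(1) by (subst (asm) integral_nonneg_eq_0_iff_AE) auto
    with pos have "AE x in ?M. False" by eventually_elim simp
    then have "AE x in lebesgue. x \<notin> \<Omega>"
      using \<Omega>(1) by (subst (asm) AE_restrict_space_iff) auto
    then have "negligible \<Omega>"
      using \<Omega>(1) by (simp add: negligible_iff_null_sets AE_iff_null_sets)
    then show False using open_not_negligible \<Omega>(1) \<open>\<Omega> \<noteq> {}\<close> by blast
  qed
  ultimately show ?thesis by blast
qed

end
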